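(* Let $M$ be an even positive integer, $h_0,\dots,h_{M-1}$ the filter coefficients of a wavelet of order $M$, and let $n,d$ be positive integers with $d\le n$ (and $2^{n-d+1}\ge M$). Then the $d$-level packet quantum wavelet transform $P^{(d)}_n$ on $n$ qubits can be implemented exactly using $\lceil\log_2M\rceil+1$ ancilla qubits and $\mathcal{O}(dn-d^2/2)+\mathcal{O}(dM^{3/2})$ Toffoli gates and elementary one- and two-qubit gates. *)

theory Defs
  imports Complex_Main
begin

type_synonym op = "nat \<Rightarrow> nat \<Rightarrow> complex"

definition idm :: op where
  "idm i j = (if i = j then 1 else 0)"

definition mprod :: "nat \<Rightarrow> op \<Rightarrow> op \<Rightarrow> op" where
  "mprod D A B = (\<lambda>i j. \<Sum>k<D. A i k * B k j)"

text \<open>U is unitary as a D x D matrix (U^* U = I; equivalent to unitarity in finite dimension).\<close>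
definition unitary_mat :: "nat \<Rightarrow> op \<Rightarrow> bool" where
  "unitary_mat D U \<longleftrightarrow> (\<forall>i<D. \<forall>j<D. (\<Sum>k<D. cnj (U k i) * U k j) = idm i j)"

text \<open>Computational basis state x < 2^N of N qubits: qubit i holds bit i of x.\<close>
definition qbit :: "nat \<Rightarrow> nat \<Rightarrow> bool" where
  "qbit x i \<longleftrightarrow> odd (x div 2 ^ i)"

definition sub_index :: "nat list \<Rightarrow> nat \<Rightarrow> nat" where
  "sub_index qs x = (\<Sum>j<length qs. if qbit x (qs ! j) then 2 ^ j else 0)"

text \<open>A gate: a matrix U acting on the (ordered) list of qubits qs.\<close>
type_synonym gate = "op \<times> nat list"

definition lift_gate :: "nat \<Rightarrow> gate \<Rightarrow> op" where
  "lift_gate N g = (\<lambda>x y.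
     if (\<forall>i<N. i \<notin> set (snd g) \<longrightarrow> qbit x i = qbit y i)
     then fst g (sub_index (snd g) x) (sub_index (snd g) y) else 0)"

text \<open>Toffoli (CCNOT) on 3 qubits: local qubits 0,1 are controls, qubit 2 the target.\<close>
definition toffoli :: op where
  "toffoli x y = (if x < 8 \<and> y = (if x = 3 then 7 else if x = 7 then 3 else x) then 1 else 0)"

definition allowed_gate :: "nat \<Rightarrow> gate \<Rightarrow> bool" where
  "allowed_gate N g \<longleftrightarrow> distinct (snd g) \<and> (\<forall>q\<in>set (snd g). q < N) \<and>
     (((length (snd g) = 1 \<or> length (snd g) = 2) \<and> unitary_mat (2 ^ length (snd g)) (fst g))
      \<or> (length (snd g) = 3 \<and> fst g = toffoli))"

fun circ_op :: "nat \<Rightarrow> gate list \<Rightarrow> op" where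
  "circ_op N [] = idm"
| "circ_op N (g # gs) = mprod (2 ^ N) (circ_op N gs) (lift_gate N g)"

text \<open>The circuit C on n + a qubits implements the 2^n x 2^n matrix U exactly using a ancilla
  qubits (qubits n..n+a-1), which start in and are returned to |0>:
  C (|x> (x) |0^a>) = (U |x>) (x) |0^a> for every basis state x.\<close>
definition implements :: "nat \<Rightarrow> nat \<Rightarrow> gate list \<Rightarrow> op \<Rightarrow> bool" where
  "implements n a C U \<longleftrightarrow> (\<forall>g\<in>set C. allowed_gate (n + a) g) \<and>
     (\<forall>x<2 ^ n. \<forall>y<2 ^ (n + a). circ_op (n + a) C y x = (if y < 2 ^ n then U y x else 0))"

definition hz :: "nat \<Rightarrow> (nat \<Rightarrow> real) \<Rightarrow> nat \<Rightarrow> real" where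
  "hz M h k = (if k < M then h k else 0)"

definition wavelet_filter :: "nat \<Rightarrow> (nat \<Rightarrow> real) \<Rightarrow> bool" where
  "wavelet_filter M h \<longleftrightarrow> M > 0 \<and> even M \<and>
     (\<Sum>k<M. h k) = sqrt 2 \<and>
     (\<forall>m. (\<Sum>k<M. h k * hz M h (k + 2 * m)) = (if m = 0 then 1 else 0))"

definition gz :: "nat \<Rightarrow> (nat \<Rightarrow> real) \<Rightarrow> nat \<Rightarrow> real" where
  "gz M h k = (if k < M then (-1) ^ k * h (M - 1 - k) else 0)"

text \<open>Wavelet kernel on 2^m points (periodic): even rows 2i carry the low-pass filter
  shifted by 2i, odd rows 2i+1 the high-pass filter shifted by 2i.\<close>
definition wkernel :: "nat \<Rightarrow> (nat \<Rightarrow> real) \<Rightarrow> nat \<Rightarrow> op" where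
  "wkernel M h m = (\<lambda>i j. let D = 2 ^ m; s = 2 * (i div 2) in
     complex_of_real (if even i then hz M h ((j + D - s) mod D) else gz M h ((j + D - s) mod D)))"

definition shuffle :: "nat \<Rightarrow> op" where
  "shuffle m = (\<lambda>i j. let H = 2 ^ (m - 1) in
     if (i < H \<and> j = 2 * i) \<or> (H \<le> i \<and> i < 2 * H \<and> j = 2 * (i - H) + 1) then 1 else 0)"

definition blockdiag :: "nat \<Rightarrow> op \<Rightarrow> op" where
  "blockdiag m A = (\<lambda>x y. if x div 2 ^ m = y div 2 ^ m then A (x mod 2 ^ m) (y mod 2 ^ m) else 0)"

text \<open>Level k (1-based) of the packet transform on n qubits:
  I_{2^(k-1)} (x) (Pi_{2^(n-k+1)} D_{2^(n-k+1)}).\<close>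
definition packet_level :: "nat \<Rightarrow> (nat \<Rightarrow> real) \<Rightarrow> nat \<Rightarrow> nat \<Rightarrow> op" where
  "packet_level M h n k = blockdiag (n - k + 1)
     (mprod (2 ^ (n - k + 1)) (shuffle (n - k + 1)) (wkernel M h (n - k + 1)))"

fun packet_qwt :: "nat \<Rightarrow> (nat \<Rightarrow> real) \<Rightarrow> nat \<Rightarrow> nat \<Rightarrow> op" where
  "packet_qwt M h n 0 = idm"
| "packet_qwt M h n (Suc k) = mprod (2 ^ n) (packet_level M h n (Suc k)) (packet_qwt M h n k)"

end

theory Submission
  imports Defs
begin

text \<open>
  On a signal with two channels (even and odd samples) a wavelet filter of order \<open>M = 2 * K\<close> is a
  paraunitary matrix polynomial in the shift, and as such a product of rotations of the channel
  qubit and shifts of one of the channels by one position, with \<open>O(M)\<close> factors. Performing these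
  shifts on all \<open>m - 1\<close> position qubits would cost \<open>O(M * m)\<close> gates. Instead, split the position
  into a low part of \<open>b\<close> bits, with \<open>K \<le> B = 2 ^ b < M\<close>, and a high part. Let \<open>F\<close> and \<open>V\<close> be the
  filters that act cyclically modulo \<open>2 * B\<close> on the low part extended by an ancilla \<open>c\<close>, and
  modulo \<open>B\<close> on the low part alone. As the filter moves a signal by less than \<open>K\<close> positions, it is
  \<open>A + S * A'\<close> with \<open>S\<close> the shift of the high part, \<open>V = A + A'\<close>, and \<open>F\<close> sends the input with
  \<open>c = 0\<close> to \<open>A\<close> for \<open>c = 0\<close> and \<open>A'\<close> for \<open>c = 1\<close>. Here \<open>V\<^sup>-\<^sup>1 * A\<close> and \<open>V\<^sup>-\<^sup>1 * A'\<close> are complementary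
  orthogonal projections, so applying \<open>F\<close>, then \<open>V\<^sup>-\<^sup>1\<close>, then \<open>S\<close> controlled by \<open>c\<close>, then \<open>F\<close> again
  realises the filter on the whole register and returns \<open>c\<close> to 0. The only operation on the high
  part is a single controlled increment, for which \<open>O(m)\<close> gates suffice: Cuccaro's adder, with one
  half of the register serving as dirty workspace for the other. The small filters cost
  \<open>O(M * b)\<close> gates, which is within \<open>O(M powr (3 / 2))\<close>.
\<close>

section \<open>Registers and the action of circuits on states\<close>

type_synonym cfg = "nat \<Rightarrow> bool"

primrec rval :: "nat list \<Rightarrow> cfg \<Rightarrow> int" where
  "rval [] y = 0"
| "rval (b # bs) y = of_bool (y b) + 2 * rval bs y"

text \<open>Values are integers, so negative numbers and overflow are allowed as input: only the low
  bits are written, which makes every register operation arithmetic modulo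
  \<open>2 ^ length bs\<close> without an explicit reduction.\<close>

primrec rupd :: "nat list \<Rightarrow> int \<Rightarrow> cfg \<Rightarrow> cfg" where
  "rupd [] v y = y"
| "rupd (b # bs) v y = (rupd bs (v div 2) y)(b := odd v)"

lemma rupd_outside: "i \<notin> set bs \<Longrightarrow> rupd bs v y i = y i"
  by (induction bs arbitrary: v) auto

lemma rupd_inside: "i \<in> set bs \<Longrightarrow> rupd bs v y i = rupd bs v y' i"
  by (induction bs arbitrary: v) auto

lemma rval_cong: "(\<And>i. i \<in> set bs \<Longrightarrow> y i = y' i) \<Longrightarrow> rval bs y = rval bs y'"
  by (induction bs) auto

lemma rval_fun_upd [simp]: "i \<notin> set bs \<Longrightarrow> rval bs (y(i := v)) = rval bs y"
  by (rule rval_cong) auto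

lemma rupd_fun_upd: "i \<notin> set bs \<Longrightarrow> rupd bs v (y(i := w)) = (rupd bs v y)(i := w)"
  by (induction bs arbitrary: v) (auto simp: fun_eq_iff)

lemma rval_nonneg: "0 \<le> rval bs y"
  by (induction bs) auto

lemma rval_less: "rval bs y < 2 ^ length bs"
  by (induction bs) (auto simp: of_bool_def)

lemma rval_rupd: "distinct bs \<Longrightarrow> rval bs (rupd bs v y) = v mod 2 ^ length bs"
proof (induction bs arbitrary: v)
  case (Cons b bs)
  have "v mod 2 ^ Suc (length bs) = of_bool (odd v) + 2 * (v div 2 mod 2 ^ length bs)"
    by (simp add: zmod_zmult2_eq of_bool_odd_eq_mod_2)
  moreover have "rval bs ((rupd bs (v div 2) y)(b := odd v)) = v div 2 mod 2 ^ length bs"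
    using Cons by (subst rval_fun_upd) simp_all
  ultimately show ?case by (simp only: rval.simps rupd.simps fun_upd_same length_Cons)
qed simp

lemma rval_rupd_disjoint: "set cs \<inter> set bs = {} \<Longrightarrow> rval cs (rupd bs v y) = rval cs y"
  by (rule rval_cong, rule rupd_outside, auto)

lemma rupd_rval [simp]: "rupd bs (rval bs y) y = y"
  by (induction bs) (auto simp: of_bool_def)

lemma rupd_rval_other: "rupd bs (rval bs y') y = (\<lambda>i. if i \<in> set bs then y' i else y i)"
  by (induction bs) (auto simp: fun_eq_iff)

lemma rupd_rupd: "distinct bs \<Longrightarrow> rupd bs v (rupd bs w y) = rupd bs v y"
  by (induction bs arbitrary: v w) (auto simp: rupd_fun_upd)

lemma rupd_mod: "rupd bs (v mod 2 ^ length bs) y = rupd bs v y"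
proof (induction bs arbitrary: v)
  case (Cons b bs)
  have "v mod 2 ^ Suc (length bs) div 2 = v div 2 mod 2 ^ length bs"
    by (simp add: zmod_zmult2_eq)
  moreover have "odd (v mod 2 ^ Suc (length bs)) = odd v" by (simp add: dvd_mod_iff)
  ultimately show ?case using Cons[of "v div 2"] by simp
qed simp

lemma rupd_cong_mod:
  "v mod 2 ^ length bs = w mod 2 ^ length bs \<Longrightarrow> rupd bs v y = rupd bs w y"
  by (metis rupd_mod)

lemma rval_append: "rval (xs @ ys) y = rval xs y + 2 ^ length xs * rval ys y"
  by (induction xs) (auto simp: algebra_simps)

lemma rupd_append: "rupd (xs @ ys) v y = rupd xs v (rupd ys (v div 2 ^ length xs) y)"
  by (induction xs arbitrary: v) (auto simp: zdiv_zmult2_eq)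

lemma rupd_commute:
  "set xs \<inter> set ys = {} \<Longrightarrow> rupd xs v (rupd ys w y) = rupd ys w (rupd xs v y)"
  by (induction xs arbitrary: v) (auto simp: rupd_fun_upd)

section \<open>Basis states as numbers and as wire configurations\<close>

lemma qbit_eq_bit: "qbit = bit"
  by (auto simp: fun_eq_iff qbit_def bit_iff_odd)

lemma qbit_less: "x < 2 ^ N \<Longrightarrow> N \<le> i \<Longrightarrow> \<not> qbit x i"
  by (metis qbit_eq_bit bit_take_bit_iff take_bit_nat_eq_self not_le)

lemma qbit_inject: "qbit x = qbit y \<longleftrightarrow> x = y"
  by (metis bit_eqI qbit_eq_bit)

lemma sub_index_Cons: "sub_index (q # qs) x = of_bool (qbit x q) + 2 * sub_index qs x"
proof -
  have "(\<Sum>j<length qs. if qbit x (qs ! j) then 2 ^ Suc j else 0) = 2 * sub_index qs x"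
    unfolding sub_index_def sum_distrib_left by (rule sum.cong) auto
  then show ?thesis
    unfolding sub_index_def[of "q # qs"] by (simp add: sum.lessThan_Suc_shift del: sum.lessThan_Suc power_Suc)
qed

lemma sub_index_rval: "int (sub_index qs x) = rval qs (qbit x)"
  by (induction qs) (auto simp: sub_index_Cons sub_index_def[of "[]"])

section \<open>Gates and circuits as operators on amplitude functions\<close>

definition gsem :: "gate \<Rightarrow> (cfg \<Rightarrow> complex) \<Rightarrow> cfg \<Rightarrow> complex" where
  "gsem g \<psi> y = (\<Sum>z<2 ^ length (snd g). fst g (nat (rval (snd g) y)) z * \<psi> (rupd (snd g) (int z) y))"

fun sem :: "gate list \<Rightarrow> (cfg \<Rightarrow> complex) \<Rightarrow> cfg \<Rightarrow> complex" where
  "sem [] \<psi> = \<psi>"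
| "sem (g # gs) \<psi> = sem gs (gsem g \<psi>)"

lemma sem_append: "sem (xs @ ys) \<psi> = sem ys (sem xs \<psi>)"
  by (induction xs arbitrary: \<psi>) auto

definition number :: "nat \<Rightarrow> cfg \<Rightarrow> nat" where
  "number N y = horner_sum of_bool 2 (map y [0..<N])"

lemma number_less: "number N y < 2 ^ N"
  using horner_sum_of_bool_2_less[of "map y [0..<N]", where 'a = nat] by (simp add: number_def)

lemma qbit_number: "qbit (number N y) i \<longleftrightarrow> i < N \<and> y i"
  by (auto simp: number_def qbit_eq_bit bit_horner_sum_bit_iff)

lemma qbit_number_eq: "(\<And>i. i \<ge> N \<Longrightarrow> \<not> y i) \<Longrightarrow> qbit (number N y) = y"
  by (auto simp: fun_eq_iff qbit_number) (meson not_le)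

text \<open>States are functions on configurations of all wires, so \<open>gsem\<close> carries no
  qubit count; this links it to the matrices. Row \<open>k\<close> of the lifted gate is supported
  on the columns that agree with \<open>k\<close> off \<open>qs\<close>, and these are indexed by
  the local value \<open>z\<close> written into \<open>qs\<close>.\<close>

lemma gsem_lift_gate:
  assumes k: "k < 2 ^ N" and qs: "distinct qs" "\<forall>q\<in>set qs. q < N"
  shows "gsem (U, qs) \<psi> (qbit k) = (\<Sum>j<2 ^ N. lift_gate N (U, qs) k j * \<psi> (qbit j))"
proof -
  let ?J = "{j. j < 2 ^ N \<and> (\<forall>i<N. i \<notin> set qs \<longrightarrow> qbit k i = qbit j i)}"
  have "(\<Sum>j<2 ^ N. lift_gate N (U, qs) k j * \<psi> (qbit j))
      = (\<Sum>j\<in>?J. U (sub_index qs k) (sub_index qs j) * \<psi> (qbit j))"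
    by (rule sum.mono_neutral_cong_right) (auto simp: lift_gate_def)
  also have "\<dots> = (\<Sum>z<2 ^ length qs. U (nat (rval qs (qbit k))) z * \<psi> (rupd qs (int z) (qbit k)))"
  proof (rule sum.reindex_bij_witness[where i = "\<lambda>z. number N (rupd qs (int z) (qbit k))" and j = "sub_index qs"])
    fix j assume j: "j \<in> ?J"
    have "qbit k i = qbit j i" if "i \<notin> set qs" for i
      using j k that qbit_less[of k N i] qbit_less[of j N i] by (cases "i < N") auto
    then have e: "rupd qs (int (sub_index qs j)) (qbit k) = qbit j"
      by (auto simp: sub_index_rval rupd_rval_other fun_eq_iff)
    have "qbit (number N (qbit j)) = qbit j" using j by (intro qbit_number_eq) (auto simp: qbit_less)
    then show "number N (rupd qs (int (sub_index qs j)) (qbit k)) = j"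
      by (simp add: e qbit_inject)
    show "sub_index qs j \<in> {..<2 ^ length qs}"
      using rval_less[of qs "qbit j"] by (simp flip: sub_index_rval)
    show "U (nat (rval qs (qbit k))) (sub_index qs j) * \<psi> (rupd qs (int (sub_index qs j)) (qbit k)) =
         U (sub_index qs k) (sub_index qs j) * \<psi> (qbit j)"
      unfolding e by (simp flip: sub_index_rval)
  next
    fix z :: nat assume z: "z \<in> {..<2 ^ length qs}"
    have out: "rupd qs (int z) (qbit k) i = qbit k i" if "i \<notin> set qs" for i
      using that by (rule rupd_outside)
    have e: "qbit (number N (rupd qs (int z) (qbit k))) = rupd qs (int z) (qbit k)"
    proof (rule qbit_number_eq)
      fix i assume "N \<le> i"
      then have "i \<notin> set qs" using qs by auto
      then show "\<not> rupd qs (int z) (qbit k) i" using out k qbit_less \<open>N \<le> i\<close> by simp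
    qed
    have "int (sub_index qs (number N (rupd qs (int z) (qbit k)))) = int z"
    proof -
      have "int z < 2 ^ length qs" using z by (simp add: zless_nat_eq_int_zless nat_power_eq)
      then show ?thesis using qs by (simp add: sub_index_rval e rval_rupd)
    qed
    then show "sub_index qs (number N (rupd qs (int z) (qbit k))) = z" by simp
    show "number N (rupd qs (int z) (qbit k)) \<in> ?J"
      by (auto simp: number_less e out)
  qed
  finally show ?thesis by (simp add: gsem_def)
qed

lemma circ_op_sem:
  assumes "\<forall>g\<in>set C. allowed_gate N g" and "y < 2 ^ N"
  shows "sem C \<psi> (qbit y) = (\<Sum>k<2 ^ N. circ_op N C y k * \<psi> (qbit k))"
  using assms
proof (induction C arbitrary: \<psi>)
  case Nil
  have "(\<Sum>k<2 ^ N. idm y k * \<psi> (qbit k)) = (\<Sum>k<2 ^ N. if y = k then \<psi> (qbit k) else 0)"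
    by (rule sum.cong) (auto simp: idm_def)
  then show ?case using Nil by simp
next
  case (Cons g gs)
  have g: "distinct (snd g)" "\<forall>q\<in>set (snd g). q < N"
    using Cons.prems by (auto simp: allowed_gate_def)
  have "sem (g # gs) \<psi> (qbit y) = (\<Sum>k<2 ^ N. circ_op N gs y k * gsem g \<psi> (qbit k))"
    using Cons by simp
  also have "\<dots> = (\<Sum>k<2 ^ N. \<Sum>j<2 ^ N. circ_op N gs y k * lift_gate N g k j * \<psi> (qbit j))"
    using gsem_lift_gate[OF _ g, of _ "fst g"] by (simp add: sum_distrib_left mult.assoc)
  also have "\<dots> = (\<Sum>k<2 ^ N. circ_op N (g # gs) y k * \<psi> (qbit k))"
    by (subst sum.swap) (simp add: mprod_def sum_distrib_right)
  finally show ?case .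
qed

section \<open>Increments of registers\<close>

datatype cgate = CN nat nat | TF nat nat nat

primrec cact :: "cgate \<Rightarrow> cfg \<Rightarrow> cfg" where
  "cact (CN c t) y = y(t := (y t \<noteq> y c))"
| "cact (TF a b t) y = y(t := (y t \<noteq> (y a \<and> y b)))"

definition cnot :: op where
  "cnot x y = (if x < 4 \<and> y = (if x = 1 then 3 else if x = 3 then 1 else x) then 1 else 0)"

primrec gate_of :: "cgate \<Rightarrow> gate" where
  "gate_of (CN c t) = (cnot, [c, t])"
| "gate_of (TF a b t) = (toffoli, [a, b, t])"

definition cgate_on :: "nat set \<Rightarrow> cgate \<Rightarrow> bool" where
  "cgate_on W g \<longleftrightarrow> distinct (snd (gate_of g)) \<and> set (snd (gate_of g)) \<subseteq> W"

definition prog_on :: "nat set \<Rightarrow> cgate list \<Rightarrow> bool" where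
  "prog_on W p \<longleftrightarrow> (\<forall>g\<in>set p. cgate_on W g)"

lemma prog_on_simps [simp]:
  "prog_on W []"
  "prog_on W (g # p) \<longleftrightarrow> cgate_on W g \<and> prog_on W p"
  "prog_on W (p @ p') \<longleftrightarrow> prog_on W p \<and> prog_on W p'"
  "prog_on W (rev p) \<longleftrightarrow> prog_on W p"
  "cgate_on W (CN c t) \<longleftrightarrow> c \<noteq> t \<and> c \<in> W \<and> t \<in> W"
  "cgate_on W (TF a b t) \<longleftrightarrow> a \<noteq> b \<and> a \<noteq> t \<and> b \<noteq> t \<and> a \<in> W \<and> b \<in> W \<and> t \<in> W"
  by (auto simp: prog_on_def cgate_on_def)

lemma unitary_cnot: "unitary_mat 4 cnot"
proof -
  have "{..<4::nat} = {0, 1, 2, 3}" by auto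
  then show ?thesis
    unfolding unitary_mat_def by (auto simp: cnot_def idm_def)
qed

lemma allowed_gate_of: "cgate_on {..<N} g \<Longrightarrow> allowed_gate N (gate_of g)"
  using unitary_cnot by (cases g) (auto simp: cgate_on_def allowed_gate_def)

lemma gsem_gate_of:
  assumes "cgate_on W g"
  shows "gsem (gate_of g) \<psi> y = \<psi> (cact g y)"
proof (cases g)
  case (CN c t)
  have "c \<noteq> t" using assms CN by simp
  define x where "x = nat (rval [c, t] y)"
  have x: "x < 4" by (simp add: x_def)
  have "gsem (gate_of g) \<psi> y
      = (\<Sum>z<4. if z = (if x = 1 then 3 else if x = 3 then 1 else x) then \<psi> (rupd [c, t] (int z) y) else 0)"
    unfolding gsem_def CN by (rule sum.cong) (auto simp: cnot_def x_def)
  also have "\<dots> = \<psi> (rupd [c, t] (int (if x = 1 then 3 else if x = 3 then 1 else x)) y)"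
    using x by (subst sum.delta) auto
  also have "rupd [c, t] (int (if x = 1 then 3 else if x = 3 then 1 else x)) y = cact g y"
    using \<open>c \<noteq> t\<close> by (auto simp: CN x_def fun_eq_iff)
  finally show ?thesis .
next
  case (TF a b t)
  have d: "a \<noteq> b" "a \<noteq> t" "b \<noteq> t" using assms TF by simp_all
  define x where "x = nat (rval [a, b, t] y)"
  have x: "x < 8" by (simp add: x_def)
  have "gsem (gate_of g) \<psi> y
      = (\<Sum>z<8. if z = (if x = 3 then 7 else if x = 7 then 3 else x) then \<psi> (rupd [a, b, t] (int z) y) else 0)"
    unfolding gsem_def TF by (rule sum.cong) (auto simp: toffoli_def x_def)
  also have "\<dots> = \<psi> (rupd [a, b, t] (int (if x = 3 then 7 else if x = 7 then 3 else x)) y)"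
    using x by (subst sum.delta) auto
  also have "rupd [a, b, t] (int (if x = 3 then 7 else if x = 7 then 3 else x)) y = cact g y"
    using d by (cases "y a"; cases "y b"; cases "y t") (auto simp: TF x_def fun_eq_iff)
  finally show ?thesis .
qed

abbreviation run :: "cgate list \<Rightarrow> cfg \<Rightarrow> cfg" where
  "run \<equiv> fold cact"

text \<open>A gate acts on states by pulling them back along its action on basis states; hence the
  program has to be reversed.\<close>

definition circ :: "cgate list \<Rightarrow> gate list" where
  "circ p = map gate_of (rev p)"

lemma length_circ [simp]: "length (circ p) = length p"
  by (simp add: circ_def)

lemma sem_circ: "prog_on W p \<Longrightarrow> sem (circ p) \<psi> y = \<psi> (run p y)"
proof (induction p arbitrary: y)
  case (Cons g p)
  have "sem (circ (g # p)) \<psi> y = gsem (gate_of g) (sem (circ p) \<psi>) y"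
    by (simp add: circ_def sem_append)
  then show ?case using Cons gsem_gate_of[of W g] by simp
qed (simp add: circ_def)

lemma allowed_circ: "prog_on {..<N} p \<Longrightarrow> \<forall>g\<in>set (circ p). allowed_gate N g"
  by (auto simp: circ_def prog_on_def allowed_gate_of)

lemma cact_cact: "cgate_on W g \<Longrightarrow> cact g (cact g y) = y"
  by (cases g) (auto simp: fun_eq_iff)

lemma run_rev: "prog_on W p \<Longrightarrow> run (rev p) (run p y) = y"
  by (induction p arbitrary: y) (auto simp: cact_cact)

lemma run_rev': "prog_on W p \<Longrightarrow> run p (run (rev p) y) = y"
  using run_rev[of W "rev p"] by simp

text \<open>Cuccaro et al.'s in-place adder. The wires \<open>as\<close> may carry arbitrary data.\<close>

fun adder :: "nat \<Rightarrow> nat list \<Rightarrow> nat list \<Rightarrow> cgate list" where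
  "adder c (a # as) (b # bs) =
     [CN a b, CN a c, TF b c a] @ adder a as bs @ [TF b c a, CN a c, CN c b]"
| "adder _ _ _ = []"

lemma prog_on_adder:
  "distinct (c # as @ bs) \<Longrightarrow> set (c # as @ bs) \<subseteq> W \<Longrightarrow> prog_on W (adder c as bs)"
  by (induction c as bs rule: adder.induct) auto

lemma length_adder: "length (adder c as bs) \<le> 6 * length bs"
  by (induction c as bs rule: adder.induct) auto

lemma run_adder:
  assumes "distinct (c # as @ bs)" "length as = length bs"
  shows "run (adder c as bs) y = rupd bs (rval bs y + rval as y + of_bool (y c)) y"
  using assms
proof (induction c as bs arbitrary: y rule: adder.induct)
  case (1 c a as b bs)
  \<comment> \<open>The majority is the carry out of the lowest position. The first three gates
    leave it on wire \<open>a\<close>, where the recursive call takes it as carry input; the last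
    three undo this and produce the sum bit on \<open>b\<close>.\<close>
  define m where "m \<longleftrightarrow> (y a \<and> y b) \<or> (y a \<and> y c) \<or> (y b \<and> y c)"
  define y1 where "y1 = y(b := (y b \<noteq> y a), c := (y c \<noteq> y a), a := m)"
  define V where "V = rval bs y + rval as y + of_bool m"
  have y1: "run [CN a b, CN a c, TF b c a] y = y1"
    using 1(2) by (auto simp: y1_def fun_eq_iff m_def)
  have "rval bs y1 = rval bs y" "rval as y1 = rval as y" "y1 a = m"
    using 1(2) by (auto simp: y1_def)
  then have "run (adder a as bs) y1 = rupd bs V y1"
    using 1 by (simp add: V_def)
  also have "\<dots> = (rupd bs V y)(b := (y b \<noteq> y a), c := (y c \<noteq> y a), a := m)"
    using 1(2) by (simp add: y1_def rupd_fun_upd)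
  finally have "run (adder c (a # as) (b # bs)) y
      = run [TF b c a, CN a c, CN c b] ((rupd bs V y)(b := (y b \<noteq> y a), c := (y c \<noteq> y a), a := m))"
    using y1 by simp
  also have "\<dots> = (rupd bs V y)(b := ((y b \<noteq> y a) \<noteq> y c))"
    using 1(2) by (auto simp: fun_eq_iff m_def rupd_outside)
  also have "\<dots> = rupd (b # bs) (rval (b # bs) y + rval (a # as) y + of_bool (y c)) y"
  proof -
    have "rval (b # bs) y + rval (a # as) y + of_bool (y c) = 2 * V + of_bool ((y b \<noteq> y a) \<noteq> y c)"
      by (simp add: V_def m_def of_bool_def)
    moreover have "(2 * V + of_bool P) div 2 = V" "odd (2 * V + of_bool P) = P" for P
      by (auto simp: of_bool_def)
    ultimately show ?thesis by (simp only: rupd.simps)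
  qed
  finally show ?case .
qed auto

text \<open>The adder sends the state with the difference in \<open>bs\<close> to \<open>y\<close>,
  so its reversal sends \<open>y\<close> back to that state. The wires \<open>as\<close> and
  \<open>c\<close> are untouched, hence the same summands occur in both directions.\<close>

lemma run_rev_adder:
  assumes "distinct (c # as @ bs)" "length as = length bs"
  shows "run (rev (adder c as bs)) y = rupd bs (rval bs y - rval as y - of_bool (y c)) y"
proof -
  let ?y' = "rupd bs (rval bs y - rval as y - of_bool (y c)) y"
  have "rval as ?y' = rval as y" "?y' c = y c"
    using assms(1) by (auto simp: rupd_outside intro!: rval_rupd_disjoint)
  then have "run (adder c as bs) ?y' = rupd bs (rval bs ?y' + rval as y + of_bool (y c)) y"
    using run_adder[OF assms] assms(1) by (simp add: rupd_rupd)
  also have "\<dots> = rupd bs (rval bs y) y"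
  proof (rule rupd_cong_mod)
    have "((a - s - t) mod D + s + t) mod D = a mod D" for a s t D :: int
      using mod_add_left_eq[of "a - s - t" D "s + t"] by (simp add: add.assoc)
    then show "(rval bs ?y' + rval as y + of_bool (y c)) mod 2 ^ length bs = rval bs y mod 2 ^ length bs"
      using assms(1) by (simp only: rval_rupd distinct.simps distinct_append)
  qed
  finally have "run (adder c as bs) ?y' = y" by simp
  then show ?thesis
    using run_rev[OF prog_on_adder[OF assms(1) subset_refl]] by metis
qed

text \<open>Adding and subtracting dirty data leaves only the effect of the two carry inputs.\<close>

definition dirty_inc :: "nat \<Rightarrow> nat \<Rightarrow> nat list \<Rightarrow> nat list \<Rightarrow> cgate list" where
  "dirty_inc c z as bs = adder c as bs @ rev (adder z as bs)"

lemma prog_on_dirty_inc: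
  "distinct (c # z # as @ bs) \<Longrightarrow> set (c # z # as @ bs) \<subseteq> W \<Longrightarrow> prog_on W (dirty_inc c z as bs)"
  by (auto simp: dirty_inc_def intro!: prog_on_adder)

lemma length_dirty_inc: "length (dirty_inc c z as bs) \<le> 12 * length bs"
  using length_adder[of c as bs] length_adder[of z as bs] by (simp add: dirty_inc_def)

lemma run_dirty_inc:
  assumes "distinct (c # z # as @ bs)" "length as = length bs"
  shows "run (dirty_inc c z as bs) y = rupd bs (rval bs y + of_bool (y c) - of_bool (y z)) y"
proof -
  let ?y' = "rupd bs (rval bs y + rval as y + of_bool (y c)) y"
  have "rval as ?y' = rval as y" "?y' z = y z"
    using assms(1) by (auto simp: rupd_outside intro!: rval_rupd_disjoint)
  then have "run (dirty_inc c z as bs) y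
      = rupd bs (rval bs ?y' - rval as y - of_bool (y z)) y"
    using assms by (simp add: dirty_inc_def run_adder run_rev_adder rupd_rupd)
  also have "\<dots> = rupd bs (rval bs y + of_bool (y c) - of_bool (y z)) y"
    using assms(1) by (intro rupd_cong_mod) (simp add: rval_rupd mod_simps algebra_simps)
  finally show ?thesis .
qed

text \<open>The halves of the register lend each other the dirty wires; \<open>w\<close> holds the carry between them.\<close>

definition split_inc :: "nat \<Rightarrow> nat \<Rightarrow> nat \<Rightarrow> nat \<Rightarrow> nat list \<Rightarrow> cgate list" where
  "split_inc c z w e qs =
    (let L = take (length qs div 2) qs; U = drop (length qs div 2) qs;
         p = dirty_inc c z (take (Suc (length L)) (U @ [e])) (L @ [w])
     in p @ dirty_inc w z (take (length U) (L @ [e])) U @ rev p @ dirty_inc c z (take (length L) U) L)"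

lemma split_inc:
  assumes d: "distinct (c # z # w # e # qs)"
  shows prog_on_split_inc: "set (c # z # w # e # qs) \<subseteq> W \<Longrightarrow> prog_on W (split_inc c z w e qs)"
    and length_split_inc: "length (split_inc c z w e qs) \<le> 36 * length qs + 24"
    and run_split_inc_outside: "i \<notin> set qs \<Longrightarrow> run (split_inc c z w e qs) y i = y i"
    and run_split_inc: "\<not> y z \<Longrightarrow> \<not> y w \<Longrightarrow>
      run (split_inc c z w e qs) y = rupd qs (rval qs y + of_bool (y c)) y"
proof -
  define L U where "L = take (length qs div 2) qs" and "U = drop (length qs div 2) qs"
  define A1 A2 A4 where "A1 = take (Suc (length L)) (U @ [e])"
    and "A2 = take (length U) (L @ [e])" and "A4 = take (length L) U"
  define p where "p = dirty_inc c z A1 (L @ [w])"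
  have qs: "qs = L @ U" by (simp add: L_def U_def)
  have len: "length U = length L \<or> length U = Suc (length L)" by (auto simp: L_def U_def)
  have si: "split_inc c z w e qs = p @ dirty_inc w z A2 U @ rev p @ dirty_inc c z A4 L"
    by (simp add: split_inc_def Let_def L_def U_def p_def A1_def A2_def A4_def)
  have lA: "length A1 = Suc (length L)" "length A2 = length U" "length A4 = length L"
    using len by (auto simp: A1_def A2_def A4_def)
  have sub: "set A1 \<subseteq> set (U @ [e])" "set A2 \<subseteq> set (L @ [e])" "set A4 \<subseteq> set U"
    unfolding A1_def A2_def A4_def by (rule set_take_subset)+
  have "distinct (U @ [e])" "distinct (L @ [e])" "distinct U" using d by (auto simp: qs)
  then have dd: "distinct A1" "distinct A2" "distinct A4"
    unfolding A1_def A2_def A4_def by (blast intro: distinct_take)+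
  have d1: "distinct (c # z # A1 @ (L @ [w]))" and d2: "distinct (w # z # A2 @ U)"
    and d4: "distinct (c # z # A4 @ L)"
    using d sub dd unfolding qs by auto
  have onp: "prog_on W p" if "set (c # z # w # e # qs) \<subseteq> W" for W
    unfolding p_def using that sub by (intro prog_on_dirty_inc d1) (auto simp: qs)
  show "prog_on W (split_inc c z w e qs)" if W: "set (c # z # w # e # qs) \<subseteq> W"
  proof -
    have "set (w # z # A2 @ U) \<subseteq> W" "set (c # z # A4 @ L) \<subseteq> W"
      using W sub by (simp_all add: qs) blast+
    then show ?thesis using onp[OF W] d2 d4 by (simp add: si prog_on_dirty_inc)
  qed
  have "length p \<le> 12 * Suc (length L)" using length_dirty_inc[of c z A1 "L @ [w]"] by (simp add: p_def)
  moreover have "2 * length L \<le> length qs" "length U + length L = length qs" by (auto simp: L_def U_def)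
  ultimately show "length (split_inc c z w e qs) \<le> 36 * length qs + 24"
    using length_dirty_inc[of w z A2 U] length_dirty_inc[of c z A4 L] by (simp add: si)
  define y1 where "y1 = run p y"
  \<comment> \<open>The change of the high half stays symbolic until the end, where clean
    \<open>z\<close> and \<open>w\<close> identify it with the overflow.\<close>
  define \<delta> where "\<delta> = of_bool (y1 w) - (of_bool (y1 z) :: int)"
  define y2 where "y2 = rupd U (rval U y + \<delta>) y"
  have y1: "y1 = rupd (L @ [w]) (rval (L @ [w]) y + of_bool (y c) - of_bool (y z)) y"
    unfolding y1_def p_def using lA by (intro run_dirty_inc d1) simp
  have "rval U y1 = rval U y"
    unfolding y1 using d by (intro rval_rupd_disjoint) (auto simp: qs)
  then have 2: "run (dirty_inc w z A2 U) y1 = rupd U (rval U y + \<delta>) y1"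
    using run_dirty_inc[OF d2] lA by (simp add: \<delta>_def)
  have pU: "run p (rupd U v y) = rupd U v y1" for v
  proof -
    have "rval (L @ [w]) (rupd U v y) = rval (L @ [w]) y"
      using d by (intro rval_rupd_disjoint) (auto simp: qs)
    moreover have "rupd U v y c = y c" "rupd U v y z = y z"
      using d by (auto simp: qs rupd_outside)
    ultimately have "run p (rupd U v y) = rupd (L @ [w]) (rval (L @ [w]) y + of_bool (y c) - of_bool (y z)) (rupd U v y)"
      unfolding p_def using run_dirty_inc[OF d1] lA by simp
    also have "\<dots> = rupd U v y1"
      unfolding y1 using d by (intro rupd_commute) (auto simp: qs)
    finally show ?thesis .
  qed
  have "run (rev p) (rupd U (rval U y + \<delta>) y1) = y2"
    using run_rev[OF onp[OF subset_refl]] by (simp add: y2_def flip: pU)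
  moreover have y2: "rval L y2 = rval L y" "y2 c = y c" "y2 z = y z"
    using d by (auto simp: y2_def qs rupd_outside intro!: rval_rupd_disjoint)
  ultimately have fin: "run (split_inc c z w e qs) y = rupd L (rval L y + of_bool (y c) - of_bool (y z)) y2"
    using run_dirty_inc[OF d4] lA 2 by (simp add: si flip: y1_def)
  show "run (split_inc c z w e qs) y i = y i" if "i \<notin> set qs"
    unfolding fin using that by (simp add: y2_def qs rupd_outside)
  assume z: "\<not> y z" and w: "\<not> y w"
  \<comment> \<open>The incremented low half before truncation. It is at most
    \<open>2 ^ length L\<close>, so its overflow is the single bit that \<open>p\<close> writes to
    \<open>w\<close>.\<close>
  define T where "T = rval L y + of_bool (y c)"
  have T: "0 \<le> T" "T \<le> 2 ^ length L"
    using rval_nonneg[of L y] rval_less[of L y] by (auto simp: T_def of_bool_def)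
  have "y1 z = y z" unfolding y1 using d by (intro rupd_outside) (auto simp: qs)
  moreover have "w \<notin> set L" using d by (auto simp: qs)
  then have "y1 w \<longleftrightarrow> odd (T div 2 ^ length L)"
    unfolding y1 using z w d by (simp add: rval_append T_def rupd_append rupd_outside)
  moreover have "T div 2 ^ length L = of_bool (T = 2 ^ length L)"
    using T by (auto simp: of_bool_def)
  ultimately have "\<delta> = T div 2 ^ length L"
    using z by (simp add: \<delta>_def of_bool_def)
  moreover have "rval qs y + of_bool (y c) = T + 2 ^ length L * rval U y"
    by (simp add: qs rval_append T_def)
  ultimately have "rupd qs (rval qs y + of_bool (y c)) y
      = rupd L (T + 2 ^ length L * rval U y) (rupd U (rval U y + \<delta>) y)"
    by (simp add: qs rupd_append add.commute)
  also have "\<dots> = rupd L T (rupd U (rval U y + \<delta>) y)"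
    by (rule rupd_cong_mod) simp
  finally show "run (split_inc c z w e qs) y = rupd qs (rval qs y + of_bool (y c)) y"
    using z by (simp add: fin y2_def T_def)
qed

section \<open>Increments of short registers with clean carry wires\<close>

fun ripple_inc :: "nat \<Rightarrow> nat list \<Rightarrow> nat list \<Rightarrow> cgate list" where
  "ripple_inc c (a # as) (b # bs) = [TF c b a] @ ripple_inc a as bs @ [TF c b a, CN c b]"
| "ripple_inc _ _ _ = []"

lemma prog_on_ripple_inc:
  "distinct (c # as @ bs) \<Longrightarrow> set (c # as @ bs) \<subseteq> W \<Longrightarrow> prog_on W (ripple_inc c as bs)"
  by (induction c as bs rule: ripple_inc.induct) auto

lemma length_ripple_inc: "length (ripple_inc c as bs) \<le> 3 * length bs"
  by (induction c as bs rule: ripple_inc.induct) auto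

text \<open>The recursive call changes neither \<open>c\<close> nor \<open>b\<close>, so the second
  Toffoli gate cancels the first on \<open>a\<close>. The wires \<open>as\<close> may be dirty here,
  as needed for \<open>vanishes\<close>.\<close>

lemma run_ripple_inc_outside:
  assumes "distinct (c # as @ bs)" "i \<notin> set bs"
  shows "run (ripple_inc c as bs) y i = y i"
  using assms
proof (induction c as bs arbitrary: y i rule: ripple_inc.induct)
  case (1 c a as b bs)
  define y1 where "y1 = run (ripple_inc a as bs) (cact (TF c b a) y)"
  have "y1 j = cact (TF c b a) y j" if "j \<notin> set bs" for j
    using 1 that by (simp add: y1_def)
  then have "y1 a = (y a \<noteq> (y c \<and> y b))" "y1 b = y b" "y1 c = y c" "i \<noteq> a \<Longrightarrow> y1 i = y i"
    using 1(2,3) by auto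
  moreover have "run (ripple_inc c (a # as) (b # bs)) y i = run [TF c b a, CN c b] y1 i"
    by (simp add: y1_def)
  ultimately show ?case using 1(2,3) by auto
qed auto

text \<open>A clean wire \<open>a\<close> receives the carry \<open>c\<close> and \<open>b\<close>,
  which drives the increment of the higher wires and is then uncomputed, before \<open>b\<close>
  itself is flipped.\<close>

lemma run_ripple_inc:
  assumes "distinct (c # as @ bs)" "length as = length bs" "\<forall>a\<in>set as. \<not> y a"
  shows "run (ripple_inc c as bs) y = rupd bs (rval bs y + of_bool (y c)) y"
  using assms
proof (induction c as bs arbitrary: y rule: ripple_inc.induct)
  case (1 c a as b bs)
  define m where "m \<longleftrightarrow> y c \<and> y b"
  define V where "V = rval bs y + of_bool m"
  have "cact (TF c b a) y = y(a := m)" using 1(2,4) by (simp add: m_def)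
  moreover have "run (ripple_inc a as bs) (y(a := m)) = rupd bs V (y(a := m))"
    using 1 by (auto simp: V_def)
  ultimately have "run (ripple_inc c (a # as) (b # bs)) y = run [TF c b a, CN c b] ((rupd bs V y)(a := m))"
    using 1(2) by (simp add: rupd_fun_upd)
  also have "\<dots> = (rupd bs V y)(b := (y b \<noteq> y c))"
    using 1(2,4) by (auto simp: fun_eq_iff m_def rupd_outside)
  also have "\<dots> = rupd (b # bs) (rval (b # bs) y + of_bool (y c)) y"
  proof -
    have "rval (b # bs) y + of_bool (y c) = 2 * V + of_bool (y b \<noteq> y c)"
      by (simp add: V_def m_def of_bool_def)
    moreover have "(2 * V + of_bool P) div 2 = V" "odd (2 * V + of_bool P) = P" for P
      by (auto simp: of_bool_def)
    ultimately show ?thesis by (simp only: rupd.simps)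
  qed
  finally show ?case .
qed auto

text \<open>Each triple of CNOT gates is a swap with wire 0. The resulting cyclic shift of the wires
  is the permutation \<open>shuffle\<close>: it moves the channel bit from the lowest to the highest
  place.\<close>

fun rotation :: "nat \<Rightarrow> cgate list" where
  "rotation 0 = []"
| "rotation (Suc k) = rotation k @ [CN 0 (Suc k), CN (Suc k) 0, CN 0 (Suc k)]"

lemma prog_on_rotation: "{..k} \<subseteq> W \<Longrightarrow> prog_on W (rotation k)"
  by (induction k) (auto simp: subset_iff)

lemma length_rotation: "length (rotation k) = 3 * k"
  by (induction k) auto

lemma run_rotation:
  "run (rotation k) y = (\<lambda>i. if i = 0 then y k else if i \<le> k then y (i - 1) else y i)"
proof (induction k)
  case (Suc k)
  have "run (rotation (Suc k)) y = run [CN 0 (Suc k), CN (Suc k) 0, CN 0 (Suc k)]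
      (\<lambda>i. if i = 0 then y k else if i \<le> k then y (i - 1) else y i)"
    using Suc by simp
  then show ?case by (auto simp: fun_eq_iff)
qed (auto simp: fun_eq_iff)

section \<open>Factorization of paraunitary filters\<close>

type_synonym mat2 = "bool \<Rightarrow> bool \<Rightarrow> real"

definition orth :: "mat2 \<Rightarrow> bool" where
  "orth R \<longleftrightarrow> (\<forall>b b'. R False b * R False b' + R True b * R True b' = of_bool (b = b'))"

text \<open>The first column \<open>(a, c)\<close> and the determinant \<delta>, which is 1 or -1,
  determine the second column as \<delta> times \<open>(- c, a)\<close>; the row relations are then
  read off.\<close>

lemma orth_transpose:
  assumes "orth R" shows "orth (\<lambda>s b. R b s)"
proof -
  obtain a b c d where R: "R False False = a" "R False True = b" "R True False = c" "R True True = d"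
    by blast
  have 1: "a * a + c * c = 1" and 2: "a * b + c * d = 0" and 3: "b * b + d * d = 1"
    using assms unfolding orth_def by (auto simp flip: R)
  define \<delta> where "\<delta> = a * d - b * c"
  have d: "d = \<delta> * a" and b: "b = - (\<delta> * c)"
    using 1 2 unfolding \<delta>_def by algebra+
  have "\<delta> * \<delta> = 1" using 1 3 unfolding d b by algebra
  then have "a * a + b * b = 1" "a * c + b * d = 0" "c * c + d * d = 1"
    using 1 unfolding d b by algebra+
  then show ?thesis by (simp add: orth_def all_bool_eq R algebra_simps)
qed

text \<open>The Boolean argument of a signal distinguishes the even and odd samples of an input, and the
  low-pass and high-pass channels of an output.\<close>

type_synonym signal = "int \<Rightarrow> bool \<Rightarrow> complex"

datatype step = Rot mat2 | Shift | Unshift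

text \<open>Signals live on all integers, where supports and translations make sense. The cyclic
  structure of a register enters only through the periodic signals given by \<open>line\<close>
  below.\<close>

primrec lstep :: "step \<Rightarrow> signal \<Rightarrow> signal" where
  "lstep (Rot R) \<phi> = (\<lambda>p s. R s False * \<phi> p False + R s True * \<phi> p True)"
| "lstep Shift \<phi> = (\<lambda>p s. \<phi> (p + of_bool s) s)"
| "lstep Unshift \<phi> = (\<lambda>p s. \<phi> (p - of_bool s) s)"

abbreviation lsteps :: "step list \<Rightarrow> signal \<Rightarrow> signal" where
  "lsteps \<equiv> fold lstep"

primrec step_inv :: "step \<Rightarrow> step" where
  "step_inv (Rot R) = Rot (\<lambda>s b. R b s)"
| "step_inv Shift = Unshift"
| "step_inv Unshift = Shift"

definition steps_inv :: "step list \<Rightarrow> step list" where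
  "steps_inv xs = rev (map step_inv xs)"

definition orth_step :: "step \<Rightarrow> bool" where
  "orth_step x \<longleftrightarrow> (\<forall>R. x = Rot R \<longrightarrow> orth R)"

lemma orth_step_simps [simp]:
  "orth_step (Rot R) \<longleftrightarrow> orth R" "orth_step Shift" "orth_step Unshift"
  by (auto simp: orth_step_def)

lemma orth_step_inv: "orth_step x \<Longrightarrow> orth_step (step_inv x)"
  by (cases x) (auto simp: orth_transpose)

lemma orth_steps_inv: "\<forall>x\<in>set xs. orth_step x \<Longrightarrow> \<forall>x\<in>set (steps_inv xs). orth_step x"
  by (auto simp: steps_inv_def orth_step_inv)

lemma step_inv_inv [simp]: "step_inv (step_inv x) = x"
  by (cases x) auto

lemma steps_inv_inv [simp]: "steps_inv (steps_inv xs) = xs"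
  by (simp add: steps_inv_def rev_map o_def)

lemma rot_transpose:
  fixes u v :: complex
  assumes "orth R"
  shows "of_real (R False s) * (of_real (R False False) * u + of_real (R False True) * v)
       + of_real (R True s) * (of_real (R True False) * u + of_real (R True True) * v)
       = (if s then v else u)"
proof -
  have "of_real (R False s) * (of_real (R False False) * u + of_real (R False True) * v)
      + of_real (R True s) * (of_real (R True False) * u + of_real (R True True) * v)
      = of_real (R False s * R False False + R True s * R True False) * u
      + of_real (R False s * R False True + R True s * R True True) * v"
    by (simp add: algebra_simps)
  also have "\<dots> = (if s then v else u)"
    using assms unfolding orth_def by simp
  finally show ?thesis .
qed

lemma lstep_inv: "orth_step x \<Longrightarrow> lstep (step_inv x) (lstep x \<phi>) = \<phi>"
  by (cases x) (auto simp: fun_eq_iff rot_transpose)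

lemma lsteps_inv: "\<forall>x\<in>set xs. orth_step x \<Longrightarrow> lsteps (steps_inv xs) (lsteps xs \<phi>) = \<phi>"
  by (induction xs arbitrary: \<phi>) (auto simp: steps_inv_def lstep_inv)

lemma lsteps_inv': "\<forall>x\<in>set xs. orth_step x \<Longrightarrow> lsteps xs (lsteps (steps_inv xs) \<phi>) = \<phi>"
  using lsteps_inv[OF orth_steps_inv, of xs] by simp

lemma lsteps_add: "lsteps xs (\<lambda>p s. \<phi> p s + \<phi>' p s) = (\<lambda>p s. lsteps xs \<phi> p s + lsteps xs \<phi>' p s)"
proof (induction xs arbitrary: \<phi> \<phi>')
  case (Cons x xs)
  have "lstep x (\<lambda>p s. \<phi> p s + \<phi>' p s) = (\<lambda>p s. lstep x \<phi> p s + lstep x \<phi>' p s)"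
    by (cases x) (auto simp: algebra_simps)
  then show ?case using Cons by simp
qed simp

lemma lsteps_zero: "lsteps xs (\<lambda>p s. 0) = (\<lambda>p s. 0)"
proof (induction xs)
  case (Cons x xs)
  then show ?case by (cases x) auto
qed simp

text \<open>Together with additivity this allows a periodic signal to be treated, near a given
  position, as a sum of translates of one block.\<close>

lemma lsteps_translate: "lsteps xs (\<lambda>p. \<phi> (p + t)) = (\<lambda>p. lsteps xs \<phi> (p + t))"
proof (induction xs arbitrary: \<phi>)
  case (Cons x xs)
  have "lstep x (\<lambda>p. \<phi> (p + t)) = (\<lambda>p. lstep x \<phi> (p + t))"
    by (cases x) (auto simp: algebra_simps)
  then show ?case using Cons by simp
qed simp

section \<open>Matrix-valued filters and their reach\<close>

definition fir :: "nat \<Rightarrow> (nat \<Rightarrow> mat2) \<Rightarrow> signal \<Rightarrow> signal" where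
  "fir K A \<phi> = (\<lambda>p s. \<Sum>l<K. of_real (A l s False) * \<phi> (p + int l) False
                                 + of_real (A l s True) * \<phi> (p + int l) True)"

text \<open>For the matrix polynomial \<open>A(z)\<close> with coefficients \<open>A l\<close> this
  says that the transpose of \<open>A(1/z)\<close> times \<open>A(z)\<close> is the identity;
  negative lags follow by symmetry. As coefficients from \<open>K\<close> on are zero,
  \<open>l + t\<close> may run past the end.\<close>

definition paraunitary :: "nat \<Rightarrow> (nat \<Rightarrow> mat2) \<Rightarrow> bool" where
  "paraunitary K A \<longleftrightarrow> (\<forall>l\<ge>K. \<forall>s b. A l s b = 0) \<and>
     (\<forall>t b b'. (\<Sum>l<K. A l False b * A (l + t) False b' + A l True b * A (l + t) True b')
        = of_bool (t = 0 \<and> b = b'))"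

definition reach_down :: "nat \<Rightarrow> (signal \<Rightarrow> signal) \<Rightarrow> bool" where
  "reach_down D F \<longleftrightarrow> (\<forall>\<phi> \<phi>' p. (\<forall>x\<in>{p - int D..p}. \<phi> x = \<phi>' x) \<longrightarrow> F \<phi> p = F \<phi>' p)"

definition reach_up :: "nat \<Rightarrow> (signal \<Rightarrow> signal) \<Rightarrow> bool" where
  "reach_up D F \<longleftrightarrow> (\<forall>\<phi> \<phi>' p. (\<forall>x\<in>{p..p + int D}. \<phi> x = \<phi>' x) \<longrightarrow> F \<phi> p = F \<phi>' p)"

lemma reach_up_fir: "reach_up K (fir (Suc K) A)"
  by (auto simp: reach_up_def fir_def intro!: sum.cong)

text \<open>The columns of \<open>A\<close> are orthogonal to those of \<open>B\<close>. In the
  plane, with both matrices nonzero, their column spaces are thus two orthogonal lines; the columns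
  of \<open>R\<close> are unit vectors along them.\<close>

lemma orth_split:
  fixes A B :: mat2
  assumes AB: "\<And>b b'. A False b * B False b' + A True b * B True b' = 0"
    and A: "A s b \<noteq> 0" and B: "B s' b' \<noteq> 0"
  obtains R where "orth R" "\<And>b. R False True * A False b + R True True * A True b = 0"
    "\<And>b. R False False * B False b + R True False * B True b = 0"
proof -
  define x y n where "x = A False b" and "y = A True b" and "n = sqrt (x * x + y * y)"
  define R :: mat2 where
    "R = (\<lambda>s c. (if c then if s then x else - y else if s then y else x) / n)"
  have "x * x + y * y > 0"
    using A by (cases s) (auto simp: x_def y_def add_pos_nonneg add_nonneg_pos zero_less_mult_iff linorder_neq_iff)
  then have n: "n * n = x * x + y * y" "n \<noteq> 0" by (auto simp: n_def)
  have "orth R"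
    using n by (auto simp: orth_def R_def all_bool_eq divide_simps simp flip: power2_eq_square)
  moreover have "R False True * A False c + R True True * A True c = 0" for c
  proof -
    define u v where "u = B False b'" and "v = B True b'"
    have "x * u + y * v = 0" "A False c * u + A True c * v = 0"
      using AB by (auto simp: x_def y_def u_def v_def)
    then have "(x * A True c - y * A False c) * u = 0" "(x * A True c - y * A False c) * v = 0"
      by algebra+
    moreover have "u \<noteq> 0 \<or> v \<noteq> 0" using B by (cases s') (auto simp: u_def v_def)
    ultimately have "x * A True c = y * A False c" by auto
    then show ?thesis using n by (simp add: R_def divide_simps)
  qed
  moreover have "R False False * B False c + R True False * B True c = 0" for c
    using AB[of b c] n by (simp add: R_def divide_simps x_def y_def)
  ultimately show ?thesis using that by blast
qed

text \<open>Induction on the degree. If the top coefficient vanishes the degree is already lower; if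
  the bottom one vanishes, a shift of both channels splits off; otherwise the extreme coefficients
  have orthogonal column spaces, and a rotation followed by a delay of one channel lowers the
  degree. These cases cost 0, 4 and 2 steps, whence \<open>4 * K + 1\<close>. The reach of the
  inverse is carried along: each split-off part adds at most one position.\<close>

theorem paraunitary_factorization:
  assumes "paraunitary (Suc K) A"
  shows "\<exists>xs. length xs \<le> 4 * K + 1 \<and> (\<forall>x\<in>set xs. orth_step x) \<and>
    lsteps xs = fir (Suc K) A \<and> reach_down K (lsteps (steps_inv xs))"
  using assms
proof (induction K arbitrary: A)
  case 0
  then have o: "orth (A 0)" by (fastforce simp: paraunitary_def orth_def)
  have "lsteps [Rot (A 0)] = fir 1 A"
    by (auto simp: fir_def fun_eq_iff)
  moreover have "reach_down 0 (lsteps (steps_inv [Rot (A 0)]))"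
    by (auto simp: reach_down_def steps_inv_def fun_eq_iff)
  ultimately show ?case using o by (intro exI[of _ "[Rot (A 0)]"]) auto
next
  case (Suc K)
  note P = Suc.prems[unfolded paraunitary_def]
  have zero: "A l s b = 0" if "Suc (Suc K) \<le> l" for l s b using P that by blast
  have col: "(\<Sum>l<Suc (Suc K). A l False b * A (l + t) False b' + A l True b * A (l + t) True b')
      = of_bool (t = 0 \<and> b = b')" for t b b' using P by blast
  consider "\<forall>s b. A (Suc K) s b = 0" | "\<forall>s b. A 0 s b = 0"
    | s b s' b' where "A 0 s b \<noteq> 0" "A (Suc K) s' b' \<noteq> 0" by blast
  then show ?case
  proof cases
    case 1
    have "paraunitary (Suc K) A"
      unfolding paraunitary_def
    proof (intro conjI allI impI)
      fix l s b assume "Suc K \<le> l"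
      then show "A l s b = 0" using 1 zero[of l s b] by (cases "l = Suc K") auto
    next
      fix t b b'
      show "(\<Sum>l<Suc K. A l False b * A (l + t) False b' + A l True b * A (l + t) True b')
        = of_bool (t = 0 \<and> b = b')"
        using col[of b t b'] 1 by (simp only: sum.lessThan_Suc mult_zero_left add_0_right)
    qed
    then obtain xs where xs: "length xs \<le> 4 * K + 1" "\<forall>x\<in>set xs. orth_step x"
      "lsteps xs = fir (Suc K) A" "reach_down K (lsteps (steps_inv xs))" using Suc.IH by blast
    have "fir (Suc (Suc K)) A = fir (Suc K) A" using 1 by (intro ext) (simp add: fir_def)
    moreover have "reach_down (Suc K) (lsteps (steps_inv xs))"
      using xs(4) unfolding reach_down_def by force
    ultimately show ?thesis using xs by (intro exI[of _ xs]) auto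
  next
    case 2
    define A' where "A' = (\<lambda>l. A (Suc l))"
    have "paraunitary (Suc K) A'"
      unfolding paraunitary_def
    proof (intro conjI allI impI)
      fix t b b'
      show "(\<Sum>l<Suc K. A' l False b * A' (l + t) False b' + A' l True b * A' (l + t) True b')
        = of_bool (t = 0 \<and> b = b')"
        using col[of b t b'] unfolding A'_def by (subst (asm) sum.lessThan_Suc_shift) (use 2 in simp)
    qed (use zero in \<open>auto simp: A'_def\<close>)
    then obtain xs where xs: "length xs \<le> 4 * K + 1" "\<forall>x\<in>set xs. orth_step x"
      "lsteps xs = fir (Suc K) A'" "reach_down K (lsteps (steps_inv xs))" using Suc.IH by blast
    \<comment> \<open>\<open>X\<close> swaps the channels. \<open>Shift\<close> moves only the
      channel \<open>True\<close>, so two shifts conjugated by swaps move both.\<close>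
    define X where "X = Rot (\<lambda>s b. of_bool (s \<noteq> b))"
    have X: "orth_step X" by (auto simp: X_def orth_def)
    have s: "lsteps [Shift, X, Shift, X] \<phi> = (\<lambda>p. \<phi> (p + 1))" for \<phi>
      by (auto simp: fun_eq_iff X_def)
    have u: "lsteps (steps_inv [Shift, X, Shift, X]) \<phi> = (\<lambda>p. \<phi> (p - 1))" for \<phi>
      by (auto simp: fun_eq_iff X_def steps_inv_def)
    have "lsteps (xs @ [Shift, X, Shift, X]) = fir (Suc (Suc K)) A"
    proof
      fix \<phi>
      have "fir (Suc (Suc K)) A \<phi> p s = fir (Suc K) A' \<phi> (p + 1) s" for p s
        unfolding fir_def by (subst sum.lessThan_Suc_shift) (simp add: 2 A'_def add.assoc)
      then show "lsteps (xs @ [Shift, X, Shift, X]) \<phi> = fir (Suc (Suc K)) A \<phi>"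
        using s[of "lsteps xs \<phi>"] xs(3) by (simp add: fun_eq_iff)
    qed
    moreover have "reach_down (Suc K) (lsteps (steps_inv (xs @ [Shift, X, Shift, X])))"
    proof -
      have "lsteps (steps_inv (xs @ [Shift, X, Shift, X])) \<phi> = lsteps (steps_inv xs) (\<lambda>p. \<phi> (p - 1))" for \<phi>
        using u[of \<phi>] by (simp add: steps_inv_def)
      then show ?thesis using xs(4) unfolding reach_down_def by simp
    qed
    ultimately show ?thesis using xs X by (intro exI[of _ "xs @ [Shift, X, Shift, X]"]) auto
  next
    case 3
    \<comment> \<open>At the maximal lag \<open>Suc K\<close> only the product of the two extreme
      coefficients survives.\<close>
    have AB: "A 0 False b * A (Suc K) False b' + A 0 True b * A (Suc K) True b' = 0" for b b'
      using col[of b "Suc K" b'] zero by (subst (asm) sum.lessThan_Suc_shift) simp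
    obtain R where R: "orth R" and top: "\<And>b. R False True * A 0 False b + R True True * A 0 True b = 0"
      and bot: "\<And>b. R False False * A (Suc K) False b + R True False * A (Suc K) True b = 0"
      using orth_split[where A = "A 0" and B = "A (Suc K)", OF AB 3] by blast
    \<comment> \<open>\<open>C\<close> is the transpose of \<open>R\<close> times \<open>A\<close>.
      Its row \<open>True\<close> starts one coefficient late and its row \<open>False\<close> ends
      one early, so moving row \<open>True\<close> down by one yields a filter \<open>A'\<close> of
      lower degree.\<close>
    define C where "C = (\<lambda>l s b. R False s * A l False b + R True s * A l True b)"
    have C0: "C 0 True b = 0" and CK: "C (Suc K) False b = 0" for b
      using top bot by (auto simp: C_def)
    have Cz: "C l s b = 0" if "Suc (Suc K) \<le> l" for l s b using zero that by (simp add: C_def)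
    define A' :: "nat \<Rightarrow> mat2" where "A' = (\<lambda>l s b. if s then C (Suc l) True b else C l False b)"
    have RT: "R s False * R s' False + R s True * R s' True = of_bool (s = s')" for s s'
      using orth_transpose[OF R] by (simp add: orth_def)
    have RC: "R s False * C l False b + R s True * C l True b = A l s b" for l s b
    proof -
      have "R s False * C l False b + R s True * C l True b
          = (R s False * R False False + R s True * R False True) * A l False b
          + (R s False * R True False + R s True * R True True) * A l True b"
        by (simp add: C_def algebra_simps)
      then show ?thesis by (simp add: RT)
    qed
    have "paraunitary (Suc K) A'"
      unfolding paraunitary_def
    proof (intro conjI allI impI)
      fix l s b assume "Suc K \<le> l"
      then show "A' l s b = 0"
        using CK Cz[of l s b] Cz[of "Suc l" s b] by (cases "l = Suc K") (auto simp: A'_def)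
    next
      fix t b b'
      have "(\<Sum>l<Suc K. C (Suc l) True b * C (Suc l + t) True b')
          = (\<Sum>l<Suc (Suc K). C l True b * C (l + t) True b')"
        by (subst (2) sum.lessThan_Suc_shift) (simp add: C0)
      moreover have "(\<Sum>l<Suc K. C l False b * C (l + t) False b')
          = (\<Sum>l<Suc (Suc K). C l False b * C (l + t) False b')"
        by (simp add: CK)
      ultimately have "(\<Sum>l<Suc K. A' l False b * A' (l + t) False b' + A' l True b * A' (l + t) True b')
        = (\<Sum>l<Suc (Suc K). C l False b * C (l + t) False b' + C l True b * C (l + t) True b')"
        by (simp add: A'_def sum.distrib)
      also have "\<dots> = (\<Sum>l<Suc (Suc K). A l False b * A (l + t) False b' + A l True b * A (l + t) True b')"
      proof (rule sum.cong[OF refl])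
        fix l
        have "C l False b * C (l + t) False b' + C l True b * C (l + t) True b'
          = A l False b * (R False False * C (l + t) False b' + R False True * C (l + t) True b')
          + A l True b * (R True False * C (l + t) False b' + R True True * C (l + t) True b')"
          by (simp add: C_def[of] algebra_simps)
        then show "C l False b * C (l + t) False b' + C l True b * C (l + t) True b'
          = A l False b * A (l + t) False b' + A l True b * A (l + t) True b'"
          by (simp add: RC)
      qed
      finally show "(\<Sum>l<Suc K. A' l False b * A' (l + t) False b' + A' l True b * A' (l + t) True b')
        = of_bool (t = 0 \<and> b = b')" by (simp only: col)
    qed
    then obtain xs where xs: "length xs \<le> 4 * K + 1" "\<forall>x\<in>set xs. orth_step x"
      "lsteps xs = fir (Suc K) A'" "reach_down K (lsteps (steps_inv xs))" using Suc.IH by blast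
    have "lsteps (xs @ [Shift, Rot R]) = fir (Suc (Suc K)) A"
    proof (intro ext)
      fix \<phi> p s
      let ?c = "\<lambda>l s b. complex_of_real (C l s b)"
      define S where "S = (\<lambda>s l. ?c l s False * \<phi> (p + int l) False + ?c l s True * \<phi> (p + int l) True)"
      have "fir (Suc K) A' \<phi> p False = (\<Sum>l<Suc (Suc K). S False l)"
        by (simp add: fir_def A'_def CK S_def)
      moreover have "fir (Suc K) A' \<phi> (p + 1) True = (\<Sum>l<Suc (Suc K). S True l)"
        by (subst sum.lessThan_Suc_shift) (simp add: fir_def A'_def C0 S_def add.assoc)
      moreover have "lsteps (xs @ [Shift, Rot R]) \<phi> p s
          = R s False * fir (Suc K) A' \<phi> p False + R s True * fir (Suc K) A' \<phi> (p + 1) True"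
        by (simp add: xs(3))
      ultimately have "lsteps (xs @ [Shift, Rot R]) \<phi> p s
          = (\<Sum>l<Suc (Suc K). R s False * S False l + R s True * S True l)"
        by (simp only: sum_distrib_left sum.distrib)
      also have "\<dots> = fir (Suc (Suc K)) A \<phi> p s"
        unfolding fir_def
      proof (rule sum.cong[OF refl])
        fix l
        show "R s False * S False l + R s True * S True l
            = A l s False * \<phi> (p + int l) False + A l s True * \<phi> (p + int l) True"
          unfolding RC[symmetric] S_def by (simp add: algebra_simps)
      qed
      finally show "lsteps (xs @ [Shift, Rot R]) \<phi> p s = fir (Suc (Suc K)) A \<phi> p s" .
    qed
    moreover have "reach_down (Suc K) (lsteps (steps_inv (xs @ [Shift, Rot R])))"
      unfolding reach_down_def
    proof (intro allI impI)
      fix \<phi> \<phi>' :: signal and p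
      assume eq: "\<forall>x\<in>{p - int (Suc K)..p}. \<phi> x = \<phi>' x"
      let ?f = "\<lambda>\<phi>. lstep Unshift (lstep (Rot (\<lambda>s b. R b s)) \<phi>)"
      have "\<forall>x\<in>{p - int K..p}. ?f \<phi> x = ?f \<phi>' x" using eq by (auto simp: fun_eq_iff of_bool_def)
      then have "lsteps (steps_inv xs) (?f \<phi>) p = lsteps (steps_inv xs) (?f \<phi>') p"
        using xs(4) unfolding reach_down_def by blast
      then show "lsteps (steps_inv (xs @ [Shift, Rot R])) \<phi> p = lsteps (steps_inv (xs @ [Shift, Rot R])) \<phi>' p"
        by (simp add: steps_inv_def)
    qed
    ultimately show ?thesis using xs R by (intro exI[of _ "xs @ [Shift, Rot R]"]) auto
  qed
qed

text \<open>The polyphase matrix of the filter bank: rows are the low-pass and high-pass filters,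
  columns their even and odd coefficients.\<close>

definition wavelet_matrix :: "nat \<Rightarrow> (nat \<Rightarrow> real) \<Rightarrow> nat \<Rightarrow> mat2" where
  "wavelet_matrix M h l s b = (if s then gz M h (2 * l + of_bool b) else hz M h (2 * l + of_bool b))"

lemma sum_double: "(\<Sum>k<2 * N. f k) = (\<Sum>l<N. f (2 * l) + f (2 * l + 1))"
  for f :: "nat \<Rightarrow> 'a::comm_monoid_add"
  by (induction N) (auto simp: ac_simps)

text \<open>The high-pass filter is the reversed low-pass filter with alternating signs. Reversing
  the summation exchanges the two factors, flips both parities and leaves the product of the
  signs.\<close>

lemma gz_correlation:
  assumes M: "M = 2 * N"
  shows "(\<Sum>l<N. gz M h (2 * l + of_bool b) * gz M h (2 * (l + t) + of_bool b'))
    = (if b = b' then 1 else - 1) *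
      (\<Sum>l<N. hz M h (2 * l + of_bool (\<not> b')) * hz M h (2 * (l + t) + of_bool (\<not> b)))"
    (is "?l = ?c * ?r")
proof -
  have "?l = (\<Sum>l<N - t. gz M h (2 * l + of_bool b) * gz M h (2 * (l + t) + of_bool b'))"
    by (rule sum.mono_neutral_right) (auto simp: gz_def M)
  also have "\<dots> = (\<Sum>l<N - t. gz M h (2 * (N - t - Suc l) + of_bool b) * gz M h (2 * (N - t - Suc l + t) + of_bool b'))"
    by (rule sum.nat_diff_reindex[symmetric])
  also have "\<dots> = (\<Sum>l<N - t. ?c * (hz M h (2 * l + of_bool (\<not> b')) * hz M h (2 * (l + t) + of_bool (\<not> b))))"
  proof (rule sum.cong[OF refl])
    fix l assume "l \<in> {..<N - t}"
    then obtain k where N: "N = Suc (l + t + k)"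
      by (metis less_diff_conv less_iff_Suc_add lessThan_iff)
    have "gz M h (2 * (N - t - Suc l) + of_bool b) = (if b then - 1 else 1) * hz M h (2 * (l + t) + of_bool (\<not> b))"
      by (auto simp: gz_def hz_def M N)
    moreover have "gz M h (2 * (N - t - Suc l + t) + of_bool b') = (if b' then - 1 else 1) * hz M h (2 * l + of_bool (\<not> b'))"
      by (auto simp: gz_def hz_def M N)
    ultimately show "gz M h (2 * (N - t - Suc l) + of_bool b) * gz M h (2 * (N - t - Suc l + t) + of_bool b')
       = ?c * (hz M h (2 * l + of_bool (\<not> b')) * hz M h (2 * (l + t) + of_bool (\<not> b)))"
      by auto
  qed
  also have "\<dots> = ?c * (\<Sum>l<N - t. hz M h (2 * l + of_bool (\<not> b')) * hz M h (2 * (l + t) + of_bool (\<not> b)))"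
    by (simp add: sum_distrib_left)
  also have "(\<Sum>l<N - t. hz M h (2 * l + of_bool (\<not> b')) * hz M h (2 * (l + t) + of_bool (\<not> b))) = ?r"
    by (rule sum.mono_neutral_left) (auto simp: hz_def M)
  finally show ?thesis .
qed

text \<open>For equal parities the low-pass and high-pass terms add up to the full double-shift
  correlation of \<open>h\<close>; for different parities they cancel.\<close>

lemma paraunitary_wavelet:
  assumes "wavelet_filter M h" and M: "M = 2 * N"
  shows "paraunitary N (wavelet_matrix M h)"
  unfolding paraunitary_def
proof (intro conjI allI impI)
  fix l s b assume "N \<le> l"
  then show "wavelet_matrix M h l s b = 0" by (simp add: wavelet_matrix_def gz_def hz_def M)
next
  fix t b b'
  have "(\<Sum>k<M. hz M h k * hz M h (k + 2 * t)) = (\<Sum>k<M. h k * hz M h (k + 2 * t))"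
    by (rule sum.cong) (auto simp: hz_def)
  also have "\<dots> = of_bool (t = 0)" using assms(1) by (simp add: wavelet_filter_def)
  finally have "(\<Sum>k<2 * N. hz M h k * hz M h (k + 2 * t)) = of_bool (t = 0)" by (simp add: M)
  then have orth: "(\<Sum>l<N. hz M h (2 * l) * hz M h (2 * (l + t)))
      + (\<Sum>l<N. hz M h (2 * l + 1) * hz M h (2 * (l + t) + 1)) = of_bool (t = 0)"
    unfolding sum_double sum.distrib by (simp add: algebra_simps)
  have "(\<Sum>l<N. wavelet_matrix M h l False b * wavelet_matrix M h (l + t) False b'
        + wavelet_matrix M h l True b * wavelet_matrix M h (l + t) True b')
    = (\<Sum>l<N. hz M h (2 * l + of_bool b) * hz M h (2 * (l + t) + of_bool b'))
    + (if b = b' then 1 else - 1) *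
      (\<Sum>l<N. hz M h (2 * l + of_bool (\<not> b')) * hz M h (2 * (l + t) + of_bool (\<not> b)))"
    unfolding gz_correlation[OF M, symmetric] by (simp add: wavelet_matrix_def sum.distrib)
  also have "\<dots> = of_bool (t = 0 \<and> b = b')"
    using orth by (cases b; cases b') simp_all
  finally show "(\<Sum>l<N. wavelet_matrix M h l False b * wavelet_matrix M h (l + t) False b'
        + wavelet_matrix M h l True b * wavelet_matrix M h (l + t) True b') = of_bool (t = 0 \<and> b = b')" .
qed

section \<open>A filter on a long register\<close>

text \<open>Wire 0 holds the channel of a signal, the remaining wires of a register hold its position.\<close>

definition rot_gate :: "mat2 \<Rightarrow> gate" where
  "rot_gate R = (\<lambda>i j. of_real (R (odd i) (odd j)), [0])"

lemma allowed_rot_gate: "orth R \<Longrightarrow> 0 < N \<Longrightarrow> allowed_gate N (rot_gate R)"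
  by (auto simp: allowed_gate_def rot_gate_def unitary_mat_def orth_def idm_def less_Suc_eq
      numeral_2_eq_2 simp flip: of_real_mult of_real_add)

lemma gsem_rot_gate:
  "gsem (rot_gate R) \<psi> y = R (y 0) False * \<psi> (y(0 := False)) + R (y 0) True * \<psi> (y(0 := True))"
  by (simp add: gsem_def rot_gate_def numeral_2_eq_2)

primrec step_circ :: "nat list \<Rightarrow> nat list \<Rightarrow> step \<Rightarrow> gate list" where
  "step_circ as bs (Rot R) = [rot_gate R]"
| "step_circ as bs Shift = circ (ripple_inc 0 as bs)"
| "step_circ as bs Unshift = circ (rev (ripple_inc 0 as bs))"

definition steps_circ :: "nat list \<Rightarrow> nat list \<Rightarrow> step list \<Rightarrow> gate list" where
  "steps_circ as bs xs = concat (map (step_circ as bs) xs)"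

lemma length_steps_circ:
  assumes "bs \<noteq> []"
  shows "length (steps_circ as bs xs) \<le> 3 * length bs * length xs"
proof (induction xs)
  case (Cons x xs)
  have "length (step_circ as bs x) \<le> 3 * length bs"
    using assms length_ripple_inc[of 0 as bs] by (cases x; cases bs) auto
  then show ?case using Cons by (simp add: steps_circ_def)
qed (simp add: steps_circ_def)

lemma allowed_steps_circ:
  assumes "distinct (0 # as @ bs)" "set (0 # as @ bs) \<subseteq> {..<N}" "\<forall>x\<in>set xs. orth_step x"
  shows "\<forall>g\<in>set (steps_circ as bs xs). allowed_gate N g"
proof -
  have p: "prog_on {..<N} (ripple_inc 0 as bs)" using assms by (intro prog_on_ripple_inc)
  have "\<forall>g\<in>set (step_circ as bs x). allowed_gate N g" if "orth_step x" for x
    using that assms(2) allowed_circ[OF p] allowed_circ[of N "rev (ripple_inc 0 as bs)"] p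
    by (cases x) (auto simp: allowed_rot_gate)
  then show ?thesis using assms(3) by (auto simp: steps_circ_def)
qed

text \<open>The amplitudes along a register as a signal on all integers, with period
  \<open>2 ^ length bs\<close> because \<open>rupd\<close> truncates. The configuration
  \<open>y\<close> fixes all other wires.\<close>

definition line :: "nat list \<Rightarrow> (cfg \<Rightarrow> complex) \<Rightarrow> cfg \<Rightarrow> signal" where
  "line bs \<psi> y p s = \<psi> ((rupd bs p y)(0 := s))"

lemma line_at: "0 \<notin> set bs \<Longrightarrow> line bs \<psi> y (rval bs y) (y 0) = \<psi> y"
  by (simp add: line_def)

text \<open>Incrementing the position register under control of the channel wire is
  \<open>Shift\<close> on the periodic signal; the truncation in \<open>rupd\<close> absorbs the
  wraparound.\<close>

lemma line_step_circ:
  assumes d: "distinct (0 # as @ bs)" "length as = length bs" "\<forall>a\<in>set as. \<not> y a"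
  shows "line bs (sem (step_circ as bs x) \<psi>) y = lstep x (line bs \<psi> y)"
proof (intro ext)
  fix p s
  define y' where "y' = (\<lambda>p. (rupd bs p y)(0 := s))"
  have on: "prog_on UNIV (ripple_inc 0 as bs)" using d by (intro prog_on_ripple_inc) auto
  have inc: "run (ripple_inc 0 as bs) (y' p) = y' (p + of_bool s)" for p
  proof -
    have "\<forall>a\<in>set as. \<not> y' p a"
    proof
      fix a assume a: "a \<in> set as"
      then have "a \<notin> set bs" "a \<noteq> 0" using d(1) by auto
      then show "\<not> y' p a" using a d(3) by (simp add: y'_def rupd_outside)
    qed
    then have "run (ripple_inc 0 as bs) (y' p) = rupd bs (rval bs (y' p) + of_bool (y' p 0)) (y' p)"
      using d by (intro run_ripple_inc) auto
    also have "\<dots> = rupd bs (p mod 2 ^ length bs + of_bool s) (y' p)"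
      using d(1) by (simp add: y'_def rval_rupd)
    also have "\<dots> = (rupd bs (p mod 2 ^ length bs + of_bool s) y)(0 := s)"
      using d(1) by (simp add: y'_def rupd_fun_upd rupd_rupd)
    also have "\<dots> = y' (p + of_bool s)"
      unfolding y'_def by (rule arg_cong[where f = "\<lambda>y. y(0 := s)"], rule rupd_cong_mod) (simp add: mod_simps)
    finally show ?thesis .
  qed
  have ln: "line bs \<chi> y p s = \<chi> (y' p)" for \<chi> p by (simp add: line_def y'_def)
  show "line bs (sem (step_circ as bs x) \<psi>) y p s = lstep x (line bs \<psi> y) p s"
  proof (cases x)
    case (Rot R)
    then show ?thesis by (simp add: line_def gsem_rot_gate)
  next
    case Shift
    then show ?thesis by (simp only: step_circ.simps lstep.simps ln sem_circ[OF on] inc)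
  next
    case Unshift
    have "run (rev (ripple_inc 0 as bs)) (y' p) = y' (p - of_bool s)"
      using run_rev[OF on, of "y' (p - of_bool s)"] inc[of "p - of_bool s"] by simp
    moreover have "prog_on UNIV (rev (ripple_inc 0 as bs))" using on by simp
    ultimately show ?thesis using Unshift by (simp only: step_circ.simps lstep.simps ln sem_circ)
  qed
qed

lemma line_steps_circ:
  assumes "distinct (0 # as @ bs)" "length as = length bs" "\<forall>a\<in>set as. \<not> y a"
  shows "line bs (sem (steps_circ as bs xs) \<psi>) y = lsteps xs (line bs \<psi> y)"
  by (induction xs arbitrary: \<psi>)
    (auto simp: steps_circ_def sem_append line_step_circ[OF assms])

lemma sem_steps_circ:
  assumes "distinct (0 # as @ bs)" "length as = length bs" "\<forall>a\<in>set as. \<not> y a"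
  shows "sem (steps_circ as bs xs) \<psi> y = lsteps xs (line bs \<psi> y) (rval bs y) (y 0)"
  using line_at[of bs _ y] assms(1) by (simp flip: line_steps_circ[OF assms])

text \<open>Says that the wires in \<open>A\<close> are in the zero state.\<close>

definition vanishes :: "nat set \<Rightarrow> (cfg \<Rightarrow> complex) \<Rightarrow> bool" where
  "vanishes A \<psi> \<longleftrightarrow> (\<forall>y. (\<exists>a\<in>A. y a) \<longrightarrow> \<psi> y = 0)"

lemma vanishes_circ:
  assumes "vanishes A \<psi>" "prog_on W p" "\<And>y a. a \<in> A \<Longrightarrow> run p y a = y a"
  shows "vanishes A (sem (circ p) \<psi>)"
  using assms by (auto simp: vanishes_def sem_circ)

lemma run_rev_outside:
  assumes "prog_on W p" "\<And>y. run p y a = y a"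
  shows "run (rev p) y a = y a"
  using assms run_rev'[of W p y] by metis

lemma vanishes_steps_circ:
  assumes d: "distinct (0 # as @ bs)" and A: "A \<inter> set (0 # bs) = {}" and v: "vanishes A \<psi>"
  shows "vanishes A (sem (steps_circ as bs xs) \<psi>)"
  using v
proof (induction xs arbitrary: \<psi>)
  case (Cons x xs)
  have on: "prog_on UNIV (ripple_inc 0 as bs)" using d by (intro prog_on_ripple_inc) auto
  have out: "run (ripple_inc 0 as bs) y a = y a" if "a \<in> A" for y a
    using that A d by (intro run_ripple_inc_outside) auto
  have "vanishes A (sem (step_circ as bs x) \<psi>)"
  proof (cases x)
    case (Rot R)
    have "\<psi> (y(0 := v)) = 0" if "a \<in> A" "y a" for y a v
    proof -
      have "(y(0 := v)) a" using that A by auto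
      then show ?thesis using Cons.prems that(1) unfolding vanishes_def by blast
    qed
    then show ?thesis by (auto simp: Rot vanishes_def gsem_rot_gate)
  next
    case Shift
    then show ?thesis using vanishes_circ[OF Cons.prems on out] by simp
  next
    case Unshift
    then show ?thesis
      using vanishes_circ[OF Cons.prems, of UNIV "rev (ripple_inc 0 as bs)"] on run_rev_outside[OF on out] by simp
  qed
  then show ?case using Cons.IH by (simp add: steps_circ_def sem_append)
qed (simp add: steps_circ_def)

text \<open>The register without \<open>c\<close> is one wire shorter, hence \<open>tl as\<close>
  for its carries. Between the filters the carry wires are clean again, so \<open>z\<close> and
  \<open>w\<close> are taken from \<open>as\<close>, while the channel wire 0 serves as the spare
  dirty wire of the increment.\<close>

definition filter_circ :: "nat list \<Rightarrow> nat list \<Rightarrow> nat \<Rightarrow> nat list \<Rightarrow> nat \<Rightarrow> nat \<Rightarrow> step list \<Rightarrow> gate list" where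
  "filter_circ r q c as z w xs =
    steps_circ as (r @ [c]) xs @ steps_circ (tl as) r (steps_inv xs) @
    circ (split_inc c z w 0 q) @ steps_circ as (r @ [c]) xs"

text \<open>With \<open>g\<close> the input restricted to one block of \<open>r\<close>-values and \<open>e\<close> its image under the filter,
  the part \<open>e0\<close> of \<open>e\<close> inside the block and the part \<open>e1\<close> in the preceding block have preimages
  \<open>u0\<close> and \<open>u1\<close> which, for reasons of support, both live in the block itself. This makes it possible
  to erase the wire \<open>c\<close> that records which part is meant.\<close>

lemma sem_filter_circ:
  fixes r q as :: "nat list"
  defines "B \<equiv> (2::int) ^ length r"
  assumes d: "distinct (0 # r @ q @ c # as)" and len: "length as = Suc (length r)"
    and zw: "z \<in> set as" "w \<in> set as" "z \<noteq> w"
    and xs: "\<forall>x\<in>set xs. orth_step x" and up: "reach_up D (lsteps xs)"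
    and down: "reach_down D (lsteps (steps_inv xs))" and D: "int D \<le> B"
    and v: "vanishes (set (c # as)) \<psi>"
  shows "sem (filter_circ r q c as z w xs) \<psi> y = (if \<exists>a\<in>set (c # as). y a then 0
    else lsteps xs (line (r @ q) \<psi> y) (rval (r @ q) y) (y 0))"
proof -
  define F G where "F = lsteps xs" and "G = lsteps (steps_inv xs)"
  have FG: "F (G \<phi>) = \<phi>" and GF: "G (F \<phi>) = \<phi>" for \<phi>
    using lsteps_inv[OF xs] lsteps_inv'[OF xs] by (auto simp: F_def G_def)
  have F0: "F (\<lambda>p s. 0) = (\<lambda>p s. 0)" and G0: "G (\<lambda>p s. 0) = (\<lambda>p s. 0)"
    by (simp_all add: F_def G_def lsteps_zero)
  have Fadd: "F (\<lambda>p s. \<phi> p s + \<phi>' p s) = (\<lambda>p s. F \<phi> p s + F \<phi>' p s)"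
    and Gadd: "G (\<lambda>p s. \<phi> p s + \<phi>' p s) = (\<lambda>p s. G \<phi> p s + G \<phi>' p s)" for \<phi> \<phi>'
    by (simp_all add: F_def G_def lsteps_add)
  have Ftr: "F (\<lambda>p. \<phi> (p + t)) = (\<lambda>p. F \<phi> (p + t))" and Gtr: "G (\<lambda>p. \<phi> (p + t)) = (\<lambda>p. G \<phi> (p + t))" for \<phi> t
    by (simp_all add: F_def G_def lsteps_translate)
  have Fup: "F \<phi> p = F \<phi>' p" if "\<And>x. p \<le> x \<Longrightarrow> x \<le> p + int D \<Longrightarrow> \<phi> x = \<phi>' x" for \<phi> \<phi>' p
    using up that unfolding reach_up_def F_def by auto
  have Gdn: "G \<phi> p = G \<phi>' p" if "\<And>x. p - int D \<le> x \<Longrightarrow> x \<le> p \<Longrightarrow> \<phi> x = \<phi>' x" for \<phi> \<phi>' p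
    using down that unfolding reach_down_def G_def by auto
  have B: "B > 0" by (simp add: B_def)
  \<comment> \<open>The block is extended by zero, not periodically. Setting \<open>c\<close> to
    \<open>False\<close> makes \<open>g y\<close> depend only on the wires outside \<open>r\<close>,
    0 and \<open>c\<close>.\<close>
  define g :: "cfg \<Rightarrow> signal" where
    "g = (\<lambda>y p s. if 0 \<le> p \<and> p < B then \<psi> ((rupd r p y)(0 := s, c := False)) else 0)"
  define e where "e = (\<lambda>y. F (g y))"
  define e0 :: "cfg \<Rightarrow> signal" where "e0 = (\<lambda>y p s. if 0 \<le> p then e y p s else 0)"
  define e1 :: "cfg \<Rightarrow> signal" where "e1 = (\<lambda>y p s. if 0 \<le> p then 0 else e y p s)"
  define u0 u1 where "u0 = (\<lambda>y. G (e0 y))" and "u1 = (\<lambda>y. G (e1 y))"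
  have g_cong: "g y = g y'" if "\<And>i. i \<notin> set r \<Longrightarrow> i \<noteq> 0 \<Longrightarrow> i \<noteq> c \<Longrightarrow> y i = y' i" for y y'
  proof -
    have "(rupd r p y)(0 := s, c := False) = (rupd r p y')(0 := s, c := False)" for p s
    proof
      fix i
      show "((rupd r p y)(0 := s, c := False)) i = ((rupd r p y')(0 := s, c := False)) i"
        using that[of i] rupd_inside[of i r p y y'] by (cases "i \<in> set r") (auto simp: rupd_outside)
    qed
    then show ?thesis unfolding g_def by (intro ext) (simp only:)
  qed
  have e_cong: "e y = e y'" "u0 y = u0 y'" "u1 y = u1 y'" if "g y = g y'" for y y'
  proof -
    show e: "e y = e y'" using that by (simp only: e_def)
    show "u0 y = u0 y'" "u1 y = u1 y'" by (simp_all only: u0_def u1_def e0_def e1_def e)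
  qed
  have e_ge: "e y p = (\<lambda>s. 0)" if "B \<le> p \<or> p < - B" for y p
  proof -
    have "e y p = F (\<lambda>p s. 0) p"
      unfolding e_def using that D by (intro Fup) (auto simp: g_def fun_eq_iff)
    then show ?thesis by (simp add: F0)
  qed
  have Fu: "F (u0 y) = e0 y" "F (u1 y) = e1 y" for y by (simp_all add: u0_def u1_def FG)
  have usum: "u0 y p s + u1 y p s = g y p s" for y p s
  proof -
    have "e y = (\<lambda>p s. e0 y p s + e1 y p s)" by (auto simp: e0_def e1_def fun_eq_iff)
    then have "G (e y) p s = u0 y p s + u1 y p s" by (simp add: Gadd u0_def u1_def)
    then show ?thesis by (simp add: e_def GF)
  qed
  have u0_neg: "u0 y p = (\<lambda>s. 0)" if "p < 0" for y p
  proof -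
    have "u0 y p = G (\<lambda>p s. 0) p"
      unfolding u0_def using that by (intro Gdn) (auto simp: e0_def fun_eq_iff)
    then show ?thesis by (simp add: G0)
  qed
  have u1_ge: "u1 y p = (\<lambda>s. 0)" if "B \<le> p" for y p
  proof -
    have "u1 y p = G (\<lambda>p s. 0) p"
      unfolding u1_def using that D by (intro Gdn) (auto simp: e1_def fun_eq_iff)
    then show ?thesis by (simp add: G0)
  qed
  \<comment> \<open>\<open>u0\<close> vanishes to the left of the block and \<open>u1\<close> to its
    right, by the reach of the inverse. Their sum \<open>g\<close> vanishes on both sides, so each
    of them does.\<close>
  have u_out: "u0 y p = (\<lambda>s. 0)" "u1 y p = (\<lambda>s. 0)" if "p < 0 \<or> B \<le> p" for y p
  proof -
    have "g y p s = 0" for s using that by (auto simp: g_def)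
    then show "u0 y p = (\<lambda>s. 0)" "u1 y p = (\<lambda>s. 0)"
      using that usum[of y p] u0_neg[of p y] u1_ge[of p y] by (auto simp: fun_eq_iff)
  qed
  have rv: "0 \<le> rval r y" "rval r y < B" for y
    using rval_nonneg rval_less by (simp_all add: B_def)
  have rc: "rval (r @ [c]) y = rval r y + B * of_bool (y c)" for y
    by (simp add: rval_append B_def)
  have rcb: "0 \<le> rval (r @ [c]) y" "rval (r @ [c]) y < 2 * B" for y
    using rv[of y] B by (auto simp: rc of_bool_def)
  have urc: "rupd (r @ [c]) x y = rupd r x (y(c := odd (x div B)))" for x y
    by (simp add: rupd_append B_def)
  have dvB: "x div B = 0" "x mod B = x" if "0 \<le> x" "x < B" for x
    using that by auto
  have dvB1: "x div B = 1" "x mod B = x - B" if "B \<le> x" "x < 2 * B" for x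
    using that int_div_pos_eq[of x B 1 "x - B"] int_mod_pos_eq[of x B 1 "x - B"] by auto
  have dvB2: "x div B = 2" "x mod B = x - 2 * B" if "2 * B \<le> x" "x < 3 * B" for x
    using that int_div_pos_eq[of x B 2 "x - 2 * B"] int_mod_pos_eq[of x B 2 "x - 2 * B"] by auto
  have dvBm: "x mod B = x + B" if "- B \<le> x" "x < 0" for x
    using that int_mod_pos_eq[of x B "- 1" "x + B"] by auto
  have d_big: "distinct (0 # as @ (r @ [c]))" "length as = length (r @ [c])"
    and d_loc: "distinct (0 # tl as @ r)" "length (tl as) = length r"
    using d len by (cases as; auto)+
  have as_out: "a \<notin> set r" "a \<notin> set q" "a \<noteq> 0" "a \<noteq> c" if "a \<in> set as" for a
    using that d by auto
  define \<phi>1 where "\<phi>1 = sem (steps_circ as (r @ [c]) xs) \<psi>"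
  define \<phi>2 where "\<phi>2 = sem (steps_circ (tl as) r (steps_inv xs)) \<phi>1"
  define \<phi>3 where "\<phi>3 = sem (circ (split_inc c z w 0 q)) \<phi>2"
  define \<phi>4 where "\<phi>4 = sem (steps_circ as (r @ [c]) xs) \<phi>3"
  have \<phi>4: "sem (filter_circ r q c as z w xs) \<psi> = \<phi>4"
    by (simp add: filter_circ_def sem_append \<phi>4_def \<phi>3_def \<phi>2_def \<phi>1_def)
  have d_inc: "distinct (c # z # w # 0 # q)" using d zw by auto
  have on_inc: "prog_on UNIV (split_inc c z w 0 q)"
    by (rule prog_on_split_inc[OF d_inc]) simp
  have inc_out: "run (split_inc c z w 0 q) y i = y i" if "i \<notin> set q" for y i
    by (rule run_split_inc_outside[OF d_inc that])
  have "vanishes (set as) \<psi>" using v by (auto simp: vanishes_def)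
  then have "vanishes (set as) \<phi>1" unfolding \<phi>1_def using d by (intro vanishes_steps_circ d_big) auto
  then have "vanishes (set as) \<phi>2" unfolding \<phi>2_def using d by (intro vanishes_steps_circ d_loc) auto
  then have "vanishes (set as) \<phi>3"
    unfolding \<phi>3_def by (rule vanishes_circ[OF _ on_inc]) (use d inc_out in auto)
  then have v4: "vanishes (set as) \<phi>4" unfolding \<phi>4_def using d by (intro vanishes_steps_circ d_big) auto
  have s1: "\<phi>1 y = (if y c then e y (rval r y - B) (y 0) else e y (rval r y) (y 0))"
    if cl: "\<forall>a\<in>set as. \<not> y a" for y
  proof -
    \<comment> \<open>From a position below \<open>2 * B\<close> the filter sees at most up to
      \<open>3 * B\<close>. There the signal of period \<open>2 * B\<close> consists of
      \<open>g\<close> and one translated copy; the half with \<open>c\<close> set is zero.\<close>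
    have "line (r @ [c]) \<psi> y x s = g y x s + g y (x + - 2 * B) s" if "0 \<le> x" "x < 3 * B" for x s
    proof -
      consider "x < B" | "B \<le> x" "x < 2 * B" | "2 * B \<le> x" by linarith
      then show ?thesis
      proof cases
        case 1
        then show ?thesis using that d
          by (simp add: line_def urc dvB g_def rupd_fun_upd fun_upd_twist)
      next
        case 2
        have "((rupd (r @ [c]) x y)(0 := s)) c" using d 2 by (simp add: urc dvB1 rupd_outside)
        then show ?thesis using v 2 that by (simp add: line_def vanishes_def g_def)
      next
        case 3
        have "rupd r x y = rupd r (x - 2 * B) y"
          using mod_mult_self2[of x B "- 2"] by (intro rupd_cong_mod) (simp add: mult.commute flip: B_def)
        then show ?thesis using 3 that d
          by (simp add: line_def urc dvB2 g_def rupd_fun_upd fun_upd_twist)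
      qed
    qed
    then have "F (line (r @ [c]) \<psi> y) (rval (r @ [c]) y)
        = F (\<lambda>x s. g y x s + g y (x + - 2 * B) s) (rval (r @ [c]) y)"
      using rcb[of y] D by (intro Fup) (auto simp: fun_eq_iff)
    also have "\<dots> = (\<lambda>s. e y (rval (r @ [c]) y) s + e y (rval (r @ [c]) y + - 2 * B) s)"
      unfolding Fadd Ftr[of "g y" "- 2 * B"] e_def ..
    finally have "\<phi>1 y = e y (rval (r @ [c]) y) (y 0) + e y (rval (r @ [c]) y + - 2 * B) (y 0)"
      unfolding \<phi>1_def sem_steps_circ[OF d_big cl] by (simp add: F_def)
    then show ?thesis using rv[of y] by (auto simp: rc e_ge)
  qed
  have s2: "\<phi>2 y = (if y c then u1 y (rval r y) (y 0) else u0 y (rval r y) (y 0))"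
    if cl: "\<forall>a\<in>set as. \<not> y a" for y
  proof -
    have cl': "\<forall>a\<in>set (tl as). \<not> y a" using cl by (cases as) auto
    define t where "t = (if y c then e1 y else e0 y)"
    \<comment> \<open>On the window from \<open>- B\<close> to \<open>B\<close> the signal of period
      \<open>B\<close> is \<open>t\<close> plus one translate. \<open>e0\<close> lies to the right
      of the origin and \<open>e1\<close> to the left, so the copies come from opposite
      sides.\<close>
    define t' where "t' = (if y c then - B else B)"
    have "line r \<phi>1 y x s = t x s + t (x + t') s" if x: "- B \<le> x" "x < B" for x s
    proof -
      let ?y = "(rupd r x y)(0 := s)"
      have "\<forall>a\<in>set as. \<not> ?y a" "?y c = y c" "?y 0 = s"
        using cl d by (auto simp: rupd_outside as_out)
      moreover have "e ?y = e y" by (rule e_cong(1), rule g_cong) (auto simp: rupd_outside)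
      moreover have "rval r ?y = x mod B" using d by (simp add: rval_rupd B_def)
      ultimately have "line r \<phi>1 y x s = (if y c then e y (x mod B - B) s else e y (x mod B) s)"
        using s1[of ?y] by (simp add: line_def)
      then show ?thesis
        using x dvB[of x] dvBm[of x] by (cases "0 \<le> x") (auto simp: t_def t'_def e0_def e1_def e_ge)
    qed
    then have "G (line r \<phi>1 y) (rval r y) = G (\<lambda>x s. t x s + t (x + t') s) (rval r y)"
      using rv[of y] D by (intro Gdn) (auto simp: fun_eq_iff)
    also have "\<dots> = (\<lambda>s. G t (rval r y) s + G t (rval r y + t') s)"
      unfolding Gadd Gtr[of t t'] ..
    finally have "\<phi>2 y = G t (rval r y) (y 0) + G t (rval r y + t') (y 0)"
      unfolding \<phi>2_def sem_steps_circ[OF d_loc cl'] by (simp add: G_def)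
    moreover have "G t = (if y c then u1 y else u0 y)" by (simp add: t_def u0_def u1_def)
    ultimately show ?thesis using rv[of y] by (auto simp: t'_def u_out)
  qed
  \<comment> \<open>Circuits pull states back: where \<open>c\<close> is set, the controlled
    increment makes \<open>y\<close> read the amplitude of the next block. This carries the spill
    \<open>u1\<close> of a block into the block before it.\<close>
  define nxt where "nxt = (\<lambda>y. rupd q (rval q y + 1) y)"
  have s3: "\<phi>3 y = (if y c then u1 (nxt y) (rval r y) (y 0) else u0 y (rval r y) (y 0))"
    if cl: "\<forall>a\<in>set as. \<not> y a" for y
  proof -
    have "run (split_inc c z w 0 q) y = rupd q (rval q y + of_bool (y c)) y"
      using cl zw by (intro run_split_inc[OF d_inc]) auto
    then have "\<phi>3 y = \<phi>2 (if y c then nxt y else y)"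
      by (simp add: \<phi>3_def sem_circ[OF on_inc] nxt_def)
    moreover have "nxt y i = y i" if "i \<notin> set q" for i using that by (simp add: nxt_def rupd_outside)
    then have "nxt y c = y c" "nxt y 0 = y 0" "\<forall>a\<in>set as. \<not> nxt y a"
      using d cl as_out by auto
    moreover have "rval r (nxt y) = rval r y"
      unfolding nxt_def using d by (intro rval_rupd_disjoint) auto
    ultimately show ?thesis using s2[of y] s2[of "nxt y"] cl by simp
  qed
  have main: "\<phi>4 y = (if y c then 0 else lsteps xs (line (r @ q) \<psi> y) (rval (r @ q) y) (y 0))"
    if cl: "\<forall>a\<in>set as. \<not> y a"
  proof -
    let ?n = "nxt y"
    \<comment> \<open>With \<open>c\<close> clear the block holds \<open>u0\<close>, with
      \<open>c\<close> set the \<open>u1\<close> of the next block. On the doubled register they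
      stand side by side, as the second filter requires, followed by the periodic copy of
      \<open>u0\<close>.\<close>
    have "line (r @ [c]) \<phi>3 y x s = (u0 y x s + u1 ?n (x + - B) s) + u0 y (x + - 2 * B) s"
      if x: "0 \<le> x" "x < 3 * B" for x s
    proof -
      let ?y = "(rupd (r @ [c]) x y)(0 := s)"
      have "\<forall>a\<in>set as. \<not> ?y a" "?y c = odd (x div B)" "?y 0 = s"
        using cl d by (auto simp: rupd_outside urc as_out)
      moreover have "u0 ?y = u0 y" by (rule e_cong, rule g_cong) (auto simp: rupd_outside)
      moreover have "nxt ?y i = ?n i" if "i \<notin> set r" "i \<noteq> 0" "i \<noteq> c" for i
      proof -
        have "set q \<inter> set (r @ [c]) = {}" "0 \<notin> set q" using d by auto
        then have "rval q ?y = rval q y" by (simp only: rval_fun_upd rval_rupd_disjoint not_False_eq_True)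
        then show ?thesis
          using that rupd_inside[of i q "rval q y + 1" ?y y]
          by (cases "i \<in> set q") (auto simp: nxt_def rupd_outside)
      qed
      then have "u1 (nxt ?y) = u1 ?n" by (intro e_cong g_cong)
      moreover have "rval r ?y = x mod B" using d by (simp add: urc rval_rupd B_def)
      ultimately have l: "line (r @ [c]) \<phi>3 y x s = (if odd (x div B) then u1 ?n (x mod B) s else u0 y (x mod B) s)"
        using s3[of ?y] by (simp only: line_def if_True if_False)
      consider "x < B" | "B \<le> x" "x < 2 * B" | "2 * B \<le> x" by linarith
      then show ?thesis
      proof cases
        case 1
        then show ?thesis using x by (simp add: l dvB u_out)
      next
        case 2
        then show ?thesis using x by (simp add: l dvB1 u_out)
      next
        case 3
        then show ?thesis using x by (simp add: l dvB2 u_out)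
      qed
    qed
    then have "F (line (r @ [c]) \<phi>3 y) (rval (r @ [c]) y)
        = F (\<lambda>x s. (u0 y x s + u1 ?n (x + - B) s) + u0 y (x + - 2 * B) s) (rval (r @ [c]) y)"
      using rcb[of y] D by (intro Fup) (auto simp: fun_eq_iff)
    also have "\<dots> = (\<lambda>s. e0 y (rval (r @ [c]) y) s + e1 ?n (rval (r @ [c]) y + - B) s
        + e0 y (rval (r @ [c]) y + - 2 * B) s)"
      unfolding Fadd Ftr[of "u0 y" "- 2 * B"] Ftr[of "u1 ?n" "- B"] Fu ..
    finally have "\<phi>4 y = e0 y (rval (r @ [c]) y) (y 0) + e1 ?n (rval (r @ [c]) y + - B) (y 0)
        + e0 y (rval (r @ [c]) y + - 2 * B) (y 0)"
      unfolding \<phi>4_def sem_steps_circ[OF d_big cl] by (simp add: F_def)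
    \<comment> \<open>If \<open>c\<close> is set, all three terms fall outside the supports of
      \<open>e0\<close> and \<open>e1\<close>; this is what returns \<open>c\<close> to
      zero.\<close>
    then have lhs: "\<phi>4 y = (if y c then 0 else e y (rval r y) (y 0) + e ?n (rval r y - B) (y 0))"
      using rv[of y] by (auto simp: rc e0_def e1_def e_ge)
    show ?thesis
    proof (cases "y c")
      case False
      define Q where "Q = B * rval q y"
      \<comment> \<open>The reach is at most \<open>B\<close>, so at a position in the current block
        the filter on the long register sees that block and the next one only. The wraparound of
        \<open>q\<close> in \<open>nxt\<close> accounts for the end of the register.\<close>
      have "line (r @ q) \<psi> y (x + Q) s = g y x s + g ?n (x + - B) s" if x: "0 \<le> x" "x < 2 * B" for x s
      proof -
        have "rupd (r @ q) (x + Q) y = rupd r (x + Q) (rupd q (x div B + rval q y) y)"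
          using B by (simp add: rupd_append Q_def add.commute flip: B_def)
        also have "\<dots> = rupd r x (rupd q (x div B + rval q y) y)"
          by (rule rupd_cong_mod) (simp add: Q_def B_def)
        finally have l: "line (r @ q) \<psi> y (x + Q) s = \<psi> ((rupd r x (rupd q (x div B + rval q y) y))(0 := s))"
          by (simp add: line_def)
        have nc: "\<not> ?n c" using False d by (simp add: nxt_def rupd_outside)
        show ?thesis
        proof (cases "x < B")
          case True
          have "(rupd r x y)(0 := s, c := False) = (rupd r x y)(0 := s)"
            using d False by (auto simp: fun_eq_iff rupd_outside)
          then show ?thesis using True x l by (simp add: dvB g_def)
        next
          case nl: False
          have "(rupd r (x - B) ?n)(0 := s, c := False) = (rupd r (x - B) ?n)(0 := s)"
            using d nc by (auto simp: fun_eq_iff rupd_outside)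
          moreover have "rupd r (x - B) ?n = rupd r x ?n"
            by (rule rupd_cong_mod) (simp add: B_def)
          ultimately show ?thesis
            using nl x l dvB1[of x] by (simp add: g_def nxt_def add.commute)
        qed
      qed
      then have "F (\<lambda>x. line (r @ q) \<psi> y (x + Q)) (rval r y) = F (\<lambda>x s. g y x s + g ?n (x + - B) s) (rval r y)"
        using rv[of y] D B by (intro Fup) (auto simp: fun_eq_iff)
      also have "\<dots> = (\<lambda>s. e y (rval r y) s + e ?n (rval r y + - B) s)"
        unfolding Fadd Ftr[of "g ?n" "- B"] e_def ..
      finally have "F (line (r @ q) \<psi> y) (rval r y + Q) = (\<lambda>s. e y (rval r y) s + e ?n (rval r y + - B) s)"
        unfolding Ftr .
      moreover have "rval (r @ q) y = rval r y + Q" by (simp add: rval_append Q_def B_def)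
      ultimately show ?thesis using lhs False by (simp add: F_def)
    qed (simp add: lhs)
  qed
  show ?thesis
  proof (cases "\<exists>a\<in>set as. y a")
    case True
    then show ?thesis using v4 by (auto simp: \<phi>4 vanishes_def)
  next
    case False
    then show ?thesis using main by (auto simp: \<phi>4)
  qed
qed

section \<open>The packet transform\<close>

lemma rval_map_Suc: "rval (map Suc bs) y = rval bs (\<lambda>i. y (Suc i))"
  by (induction bs) auto

lemma rval_upt_qbit: "rval [0..<m] (qbit y) = int (y mod 2 ^ m)"
proof (induction m)
  case (Suc m)
  have "y mod 2 ^ Suc m = 2 ^ m * (y div 2 ^ m mod 2) + y mod 2 ^ m"
    by (simp add: mod_mult2_eq mult.commute[of 2])
  then have "int (y mod 2 ^ Suc m) = int (y mod 2 ^ m) + 2 ^ m * int (y div 2 ^ m mod 2)"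
    by simp
  also have "int (y div 2 ^ m mod 2) = of_bool (qbit y m)"
    by (simp add: qbit_def mod2_eq_if)
  finally show ?case using Suc by (simp add: rval_append)
qed simp

lemma qbit_append:
  assumes "t < 2 ^ m"
  shows "qbit (u * 2 ^ m + t) i = (if i < m then qbit t i else qbit (u * 2 ^ m) i)"
proof -
  let ?x = "u * 2 ^ m + t"
  show ?thesis
  proof (cases "i < m")
    case True
    have "take_bit m ?x = t" using assms by (simp add: take_bit_eq_mod)
    then show ?thesis using True by (metis bit_take_bit_iff qbit_eq_bit)
  next
    case False
    have "drop_bit m ?x = drop_bit m (u * 2 ^ m)" using assms by (simp add: drop_bit_eq_div)
    then have "bit ?x (m + (i - m)) = bit (u * 2 ^ m) (m + (i - m))"
      by (metis bit_drop_bit_eq comp_apply)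
    then show ?thesis using False by (simp add: qbit_eq_bit)
  qed
qed

lemma rupd_upt_qbit:
  "rupd [0..<m] v (qbit y) = qbit (y div 2 ^ m * 2 ^ m + nat (v mod 2 ^ m))"
proof -
  define t where "t = nat (v mod 2 ^ m)"
  have "int t < 2 ^ m" by (simp add: t_def)
  then have t: "t < 2 ^ m" by (metis of_nat_less_iff of_nat_numeral of_nat_power)
  have "rval [0..<m] (qbit t) = v mod 2 ^ m"
    unfolding rval_upt_qbit using t by (simp add: t_def)
  then have "rupd [0..<m] v (qbit y) = rupd [0..<m] (rval [0..<m] (qbit t)) (qbit y)"
    using rupd_mod[of "[0..<m]" v] by simp
  also have "\<dots> = (\<lambda>i. if i < m then qbit t i else qbit y i)"
    by (simp add: rupd_rval_other)
  also have "\<dots> = qbit (y div 2 ^ m * 2 ^ m + t)"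
  proof
    fix i
    have "qbit y i = qbit (y div 2 ^ m * 2 ^ m) i" if "\<not> i < m"
      using qbit_append[of "y mod 2 ^ m" m "y div 2 ^ m" i] that unfolding div_mult_mod_eq by simp
    then show "(if i < m then qbit t i else qbit y i) = qbit (y div 2 ^ m * 2 ^ m + t) i"
      by (simp add: qbit_append[OF t])
  qed
  finally show ?thesis by (simp only: t_def)
qed

text \<open>Substituting the offset of column \<open>j\<close> from \<open>2 * p\<close>, taken
  modulo the size, turns a row of the kernel into the filter itself. Since \<open>M\<close> is at
  most the size, the filter does not overlap itself; even and odd offsets then give the polyphase
  form.\<close>

lemma sum_wkernel:
  fixes \<Psi> :: "int \<Rightarrow> complex"
  assumes M: "M = 2 * N" "M \<le> 2 ^ m" and \<Psi>: "\<And>j. \<Psi> (j mod 2 ^ m) = \<Psi> j"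
    and p: "2 * p + 1 < 2 ^ m"
  shows "(\<Sum>j<2 ^ m. wkernel M h m (2 * p + of_bool s) j * \<Psi> (int j))
    = (\<Sum>l<N. wavelet_matrix M h l s False * \<Psi> (2 * (int p + int l))
           + wavelet_matrix M h l s True * \<Psi> (2 * (int p + int l) + 1))"
proof -
  define D :: nat where "D = 2 ^ m"
  define f where "f = (\<lambda>k. if s then gz M h k else hz M h k)"
  have D: "D > 0" "2 * p < D" "int D = 2 ^ m" using p by (auto simp: D_def)
  have "(\<Sum>j<2 ^ m. wkernel M h m (2 * p + of_bool s) j * \<Psi> (int j))
    = (\<Sum>j<D. f ((j + D - 2 * p) mod D) * \<Psi> (int j))"
    by (simp add: wkernel_def f_def D_def Let_def)
  also have "\<dots> = (\<Sum>k<D. f k * \<Psi> (2 * int p + int k))"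
  proof (rule sum.reindex_bij_witness[where i = "\<lambda>k. (2 * p + k) mod D" and j = "\<lambda>j. (j + D - 2 * p) mod D"])
    fix j assume "j \<in> {..<D}"
    then have j: "j < D" by simp
    have "(2 * p + (j + D - 2 * p) mod D) mod D = (2 * p + (j + D - 2 * p)) mod D" by (rule mod_add_right_eq)
    also have "\<dots> = j" using D j by simp
    finally show r: "(2 * p + (j + D - 2 * p) mod D) mod D = j" .
    show "(j + D - 2 * p) mod D \<in> {..<D}" using D by simp
    have "(2 * int p + int ((j + D - 2 * p) mod D)) mod 2 ^ m = int ((2 * p + (j + D - 2 * p) mod D) mod D)"
      by (simp only: of_nat_mod[of _ D] of_nat_add of_nat_mult of_nat_numeral D(3))
    then have "(2 * int p + int ((j + D - 2 * p) mod D)) mod 2 ^ m = int j" by (simp only: r)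
    then have "\<Psi> (2 * int p + int ((j + D - 2 * p) mod D)) = \<Psi> (int j)" using \<Psi> by metis
    then show "f ((j + D - 2 * p) mod D) * \<Psi> (2 * int p + int ((j + D - 2 * p) mod D))
        = f ((j + D - 2 * p) mod D) * \<Psi> (int j)" by (simp only:)
  next
    fix k assume k: "k \<in> {..<D}"
    have "((2 * p + k) mod D + D - 2 * p) mod D = ((2 * p + k) mod D + (D - 2 * p)) mod D"
      using D by simp
    also have "\<dots> = (2 * p + k + (D - 2 * p)) mod D" by (rule mod_add_left_eq)
    also have "\<dots> = k" using D k by simp
    finally show "((2 * p + k) mod D + D - 2 * p) mod D = k" .
    show "(2 * p + k) mod D \<in> {..<D}" using D by simp
  qed
  also have "\<dots> = (\<Sum>k<M. f k * \<Psi> (2 * int p + int k))"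
    by (rule sum.mono_neutral_right) (use M in \<open>auto simp: f_def hz_def gz_def D_def\<close>)
  also have "\<dots> = (\<Sum>l<N. f (2 * l) * \<Psi> (2 * int p + int (2 * l)) + f (2 * l + 1) * \<Psi> (2 * int p + int (2 * l + 1)))"
    unfolding M(1) by (rule sum_double)
  also have "\<dots> = (\<Sum>l<N. wavelet_matrix M h l s False * \<Psi> (2 * (int p + int l))
           + wavelet_matrix M h l s True * \<Psi> (2 * (int p + int l) + 1))"
  proof (rule sum.cong[OF refl])
    fix l
    have "wavelet_matrix M h l s False = f (2 * l)" "wavelet_matrix M h l s True = f (2 * l + 1)"
      by (simp_all add: wavelet_matrix_def f_def)
    moreover have "2 * int p + int (2 * l) = 2 * (int p + int l)"
      "2 * int p + int (2 * l + 1) = 2 * (int p + int l) + 1" by simp_all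
    ultimately show "f (2 * l) * \<Psi> (2 * int p + int (2 * l)) + f (2 * l + 1) * \<Psi> (2 * int p + int (2 * l + 1))
      = wavelet_matrix M h l s False * \<Psi> (2 * (int p + int l))
           + wavelet_matrix M h l s True * \<Psi> (2 * (int p + int l) + 1)" by (simp only:)
  qed
  finally show ?thesis .
qed

text \<open>Within a block the shuffle sends the row with top bit \<open>s\<close> and remainder
  \<open>p\<close> to the kernel row \<open>2 * p + of_bool s\<close>.\<close>

lemma sum_packet_level:
  assumes m: "m = n - k + 1" "Suc m' = m" "m \<le> n" and y: "y < 2 ^ n"
  defines "p \<equiv> y mod 2 ^ m'" and "s \<equiv> qbit y m'"
  shows "(\<Sum>x<2 ^ n. packet_level M h n k y x * \<phi> x)
    = (\<Sum>j<2 ^ m. wkernel M h m (2 * p + of_bool s) j * \<phi> (y div 2 ^ m * 2 ^ m + j))"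
proof -
  let ?W = "mprod (2 ^ m) (shuffle m) (wkernel M h m)"
  have H: "(2::nat) ^ m = 2 * 2 ^ m'" by (simp flip: m(2))
  have p: "p < 2 ^ m'" by (simp add: p_def)
  have x: "y mod 2 ^ m = 2 ^ m' * of_bool s + p"
    by (simp add: H p_def s_def qbit_def mod_mult2_eq mod2_eq_if mult.commute[of 2])
  have mm: "m - Suc 0 = m'" using m(2) by simp
  have sh: "shuffle m (y mod 2 ^ m) i = of_bool (i = 2 * p + of_bool s)" for i
    unfolding x using p by (auto simp: shuffle_def Let_def mm)
  have W: "?W (y mod 2 ^ m) j = wkernel M h m (2 * p + of_bool s) j" for j
  proof -
    have "2 * p + of_bool s < 2 ^ m" using p by (auto simp: H)
    moreover have "?W (y mod 2 ^ m) j = (\<Sum>i<2 ^ m. if i = 2 * p + of_bool s then wkernel M h m i j else 0)"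
      unfolding mprod_def sh by (rule sum.cong) auto
    ultimately show ?thesis by simp
  qed
  have "(\<Sum>x<2 ^ n. packet_level M h n k y x * \<phi> x)
      = (\<Sum>x | x < 2 ^ n \<and> y div 2 ^ m = x div 2 ^ m. ?W (y mod 2 ^ m) (x mod 2 ^ m) * \<phi> x)"
    by (rule sum.mono_neutral_cong_right) (auto simp: packet_level_def blockdiag_def m(1))
  also have "\<dots> = (\<Sum>j<2 ^ m. ?W (y mod 2 ^ m) j * \<phi> (y div 2 ^ m * 2 ^ m + j))"
  proof (rule sum.reindex_bij_witness[where j = "\<lambda>x. x mod 2 ^ m" and i = "\<lambda>j. y div 2 ^ m * 2 ^ m + j"])
    fix j :: nat assume j: "j \<in> {..<2 ^ m}"
    have "y div 2 ^ m < 2 ^ (n - m)"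
      using y m(3) by (simp add: less_mult_imp_div_less flip: power_add)
    then have "Suc (y div 2 ^ m) * 2 ^ m \<le> 2 ^ (n - m) * 2 ^ m" by (intro mult_le_mono1) simp
    then have "y div 2 ^ m * 2 ^ m + j < 2 ^ n"
      using j m(3) by (simp flip: power_add)
    then show "y div 2 ^ m * 2 ^ m + j \<in> {x. x < 2 ^ n \<and> y div 2 ^ m = x div 2 ^ m}"
      using j by simp
  qed (auto simp: div_mult_mod_eq)
  finally show ?thesis by (simp add: W)
qed

text \<open>Phrased for all states with clean ancillas, so that circuits compose directly; applied
  to a basis state it gives \<open>implements\<close>.\<close>

definition acts :: "nat \<Rightarrow> nat \<Rightarrow> gate list \<Rightarrow> op \<Rightarrow> bool" where
  "acts n a C U \<longleftrightarrow> (\<forall>g\<in>set C. allowed_gate (n + a) g) \<and>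
     (\<forall>\<psi>. vanishes {n..<n + a} \<psi> \<longrightarrow> vanishes {n..<n + a} (sem C \<psi>) \<and>
        (\<forall>y<2 ^ n. sem C \<psi> (qbit y) = (\<Sum>k<2 ^ n. U y k * \<psi> (qbit k))))"

lemma acts_Nil: "acts n a [] idm"
proof -
  have "(\<Sum>k<2 ^ n. idm y k * f k) = f y" if "y < 2 ^ n" for y and f :: "nat \<Rightarrow> complex"
  proof -
    have "(\<Sum>k<2 ^ n. idm y k * f k) = (\<Sum>k<2 ^ n. if y = k then f k else 0)"
      by (rule sum.cong) (auto simp: idm_def)
    then show ?thesis using that by simp
  qed
  then show ?thesis by (simp add: acts_def)
qed

lemma acts_append:
  assumes "acts n a C U" "acts n a C' U'"
  shows "acts n a (C @ C') (mprod (2 ^ n) U' U)"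
proof -
  have "sem C' (sem C \<psi>) (qbit y) = (\<Sum>k<2 ^ n. mprod (2 ^ n) U' U y k * \<psi> (qbit k))"
    if "vanishes {n..<n + a} \<psi>" "y < 2 ^ n" for \<psi> y
  proof -
    have "sem C' (sem C \<psi>) (qbit y) = (\<Sum>i<2 ^ n. U' y i * (\<Sum>k<2 ^ n. U i k * \<psi> (qbit k)))"
      using assms that unfolding acts_def by simp
    also have "\<dots> = (\<Sum>k<2 ^ n. \<Sum>i<2 ^ n. U' y i * U i k * \<psi> (qbit k))"
      by (subst sum.swap) (simp add: sum_distrib_left mult.assoc)
    also have "\<dots> = (\<Sum>k<2 ^ n. mprod (2 ^ n) U' U y k * \<psi> (qbit k))"
      by (simp add: mprod_def sum_distrib_right)
    finally show ?thesis .
  qed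
  then show ?thesis using assms by (auto simp: acts_def sem_append)
qed

lemma qbit_high:
  assumes "2 ^ n \<le> y" "y < 2 ^ (n + a)"
  shows "\<exists>i\<in>{n..<n + a}. qbit y i"
proof (rule ccontr)
  assume n: "\<not> (\<exists>i\<in>{n..<n + a}. qbit y i)"
  have "qbit y i = qbit (y mod 2 ^ n) i" for i
  proof (cases "i < n")
    case True
    then show ?thesis by (simp add: qbit_eq_bit bit_take_bit_iff flip: take_bit_eq_mod)
  next
    case False
    then have "\<not> qbit y i" using n assms(2) qbit_less[of y "n + a" i] by (cases "i < n + a") auto
    then show ?thesis using False qbit_less[of "y mod 2 ^ n" n i] by simp
  qed
  then have "y = y mod 2 ^ n" using qbit_inject by blast
  then show False using assms(1) by (metis mod_less_divisor not_le pos2 zero_less_power)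
qed

lemma acts_implements:
  assumes "acts n a C U"
  shows "implements n a C U"
  unfolding implements_def
proof (intro conjI allI impI)
  show C: "\<forall>g\<in>set C. allowed_gate (n + a) g" using assms by (simp add: acts_def)
  fix x y :: nat assume x: "x < 2 ^ n" and y: "y < 2 ^ (n + a)"
  have delta: "(\<Sum>k<D. f k * of_bool (qbit k = qbit x)) = (if x < D then f x else 0)" for D and f :: "nat \<Rightarrow> complex"
  proof -
    have "(\<Sum>k<D. f k * of_bool (qbit k = qbit x)) = (\<Sum>k<D. if k = x then f k else 0)"
      by (rule sum.cong) (auto simp: qbit_inject)
    then show ?thesis by simp
  qed
  define \<psi> :: "cfg \<Rightarrow> complex" where "\<psi> = (\<lambda>z. of_bool (z = qbit x))"
  have v: "vanishes {n..<n + a} \<psi>"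
    using qbit_less[OF x] by (auto simp: vanishes_def \<psi>_def)
  have "(2::nat) ^ n \<le> 2 ^ (n + a)" by (rule power_increasing) auto
  then have "x < 2 ^ (n + a)" using x by linarith
  then have "circ_op (n + a) C y x = sem C \<psi> (qbit y)"
    using circ_op_sem[OF C y, of \<psi>] by (simp add: \<psi>_def delta)
  also have "\<dots> = (if y < 2 ^ n then U y x else 0)"
  proof (cases "y < 2 ^ n")
    case True
    then have "sem C \<psi> (qbit y) = (\<Sum>k<2 ^ n. U y k * \<psi> (qbit k))"
      using assms v unfolding acts_def by blast
    then show ?thesis using True x by (simp add: \<psi>_def delta)
  next
    case False
    then have "\<exists>i\<in>{n..<n + a}. qbit y i" using y by (intro qbit_high) auto
    moreover have "vanishes {n..<n + a} (sem C \<psi>)" using assms v unfolding acts_def by blast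
    ultimately have "sem C \<psi> (qbit y) = 0" unfolding vanishes_def by blast
    then show ?thesis using False by simp
  qed
  finally show "circ_op (n + a) C y x = (if y < 2 ^ n then U y x else 0)" .
qed

text \<open>\<open>C\<close> filters the wires below \<open>m\<close> with the channel on wire 0,
  and the rotation supplies the shuffle. The wires from \<open>m\<close> to \<open>n - 1\<close> are
  untouched and number the diagonal blocks.\<close>

lemma acts_level:
  assumes M: "M = 2 * N" "M \<le> 2 ^ m" and m: "m = n - k + 1" "m \<le> n"
    and C: "\<forall>g\<in>set C. allowed_gate (n + a) g"
    and sem: "\<And>\<psi> y. vanishes {n..<n + a} \<psi> \<Longrightarrow> sem C \<psi> y = (if \<exists>i\<in>{n..<n + a}. y i then 0
      else fir N (wavelet_matrix M h) (line [1..<m] \<psi> y) (rval [1..<m] y) (y 0))"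
  shows "acts n a (C @ circ (rotation (m - 1))) (packet_level M h n k)"
proof -
  obtain m' where m': "m = Suc m'" using m(1) by simp
  have on: "prog_on {..<n + a} (rotation (m - 1))"
    using m m' by (intro prog_on_rotation) auto
  have out: "run (rotation (m - 1)) y i = y i" if "m \<le> i" for y i
    using that by (simp add: run_rotation m')
  show ?thesis
    unfolding acts_def
  proof (intro conjI allI impI)
    show "\<forall>g\<in>set (C @ circ (rotation (m - 1))). allowed_gate (n + a) g"
      using C allowed_circ[OF on] by auto
    fix \<psi> assume v: "vanishes {n..<n + a} \<psi>"
    have "vanishes {n..<n + a} (sem C \<psi>)" by (auto simp: vanishes_def sem[OF v])
    then show "vanishes {n..<n + a} (sem (C @ circ (rotation (m - 1))) \<psi>)"
      unfolding sem_append using out m by (intro vanishes_circ[OF _ on]) auto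
    fix y :: nat assume y: "y < 2 ^ n"
    define y' where "y' = run (rotation (m - 1)) (qbit y)"
    define p where "p = y mod 2 ^ m'"
    define s where "s = qbit y m'"
    \<comment> \<open>The periodic extension of the amplitudes in the diagonal block that contains
      \<open>y\<close>.\<close>
    define \<Psi> :: "int \<Rightarrow> complex" where "\<Psi> = (\<lambda>j. \<psi> (qbit (y div 2 ^ m * 2 ^ m + nat (j mod 2 ^ m))))"
    have y': "y' 0 = s" "\<And>i. i < m' \<Longrightarrow> y' (Suc i) = qbit y i" "\<And>i. m \<le> i \<Longrightarrow> y' i = qbit y i"
      by (auto simp: y'_def run_rotation m' s_def)
    have upt: "[1..<m] = map Suc [0..<m']" by (simp add: m' map_Suc_upt)
    have "rval [1..<m] y' = rval [0..<m'] (qbit y)"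
      unfolding upt rval_map_Suc by (rule rval_cong) (simp add: y')
    then have r: "rval [1..<m] y' = int p" by (simp add: rval_upt_qbit p_def)
    have upt0: "[0..<m] = 0 # [1..<m]" unfolding m' by (subst upt_conv_Cons) simp_all
    have l: "line [1..<m] \<psi> y' x t = \<Psi> (2 * x + of_bool t)" for x t
    proof -
      have "(rupd [1..<m] x y')(0 := t) = rupd [0..<m] (2 * x + of_bool t) y'"
        unfolding upt0 by (cases t) simp_all
      also have "\<dots> = rupd [0..<m] (2 * x + of_bool t) (qbit y)"
      proof
        fix i
        show "rupd [0..<m] (2 * x + of_bool t) y' i = rupd [0..<m] (2 * x + of_bool t) (qbit y) i"
          using y'(3)[of i] by (cases "i < m") (auto simp: rupd_outside intro!: rupd_inside)
      qed
      finally show ?thesis by (simp only: line_def rupd_upt_qbit \<Psi>_def)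
    qed
    have z: "\<not> (\<exists>i\<in>{n..<n + a}. y' i)" using qbit_less[OF y] m y'(3) by auto
    have "sem (C @ circ (rotation (m - 1))) \<psi> (qbit y) = sem C \<psi> y'"
      by (simp only: sem_append sem_circ[OF on] y'_def)
    also have "\<dots> = fir N (wavelet_matrix M h) (line [1..<m] \<psi> y') (int p) s"
      unfolding sem[OF v] y'(1) r using z by (rule if_not_P)
    also have "\<dots> = (\<Sum>l<N. wavelet_matrix M h l s False * \<Psi> (2 * (int p + int l))
           + wavelet_matrix M h l s True * \<Psi> (2 * (int p + int l) + 1))"
      unfolding fir_def l by simp
    also have "\<dots> = (\<Sum>j<2 ^ m. wkernel M h m (2 * p + of_bool s) j * \<Psi> (int j))"
    proof (rule sum_wkernel[OF M, symmetric])
      show "\<Psi> (j mod 2 ^ m) = \<Psi> j" for j by (simp add: \<Psi>_def)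
      have "p < 2 ^ m'" by (simp add: p_def)
      then show "2 * p + 1 < 2 ^ m" by (simp add: m')
    qed
    also have "\<dots> = (\<Sum>j<2 ^ m. wkernel M h m (2 * p + of_bool s) j * \<psi> (qbit (y div 2 ^ m * 2 ^ m + j)))"
    proof (rule sum.cong[OF refl])
      fix j :: nat assume "j \<in> {..<2 ^ m}"
      then have "int j < 2 ^ m" by (metis lessThan_iff of_nat_less_iff of_nat_numeral of_nat_power)
      then show "wkernel M h m (2 * p + of_bool s) j * \<Psi> (int j)
        = wkernel M h m (2 * p + of_bool s) j * \<psi> (qbit (y div 2 ^ m * 2 ^ m + j))"
        by (simp add: \<Psi>_def)
    qed
    also have "\<dots> = (\<Sum>x<2 ^ n. packet_level M h n k y x * \<psi> (qbit x))"
      unfolding p_def s_def by (rule sum_packet_level[OF m(1) m'[symmetric] m(2) y, symmetric])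
    finally show "sem (C @ circ (rotation (m - 1))) \<psi> (qbit y)
      = (\<Sum>x<2 ^ n. packet_level M h n k y x * \<psi> (qbit x))" .
  qed
qed

text \<open>The bounds on \<open>M\<close> give \<open>K < 2 ^ b\<close>, so blocks of size
  \<open>2 ^ b\<close> exceed the reach of the filter. The \<open>b + 2\<close> ancillas are the
  wire \<open>c\<close> and \<open>b + 1\<close> carry wires. Each of the three short filters has at
  most \<open>2 * M\<close> steps of at most \<open>3 * Suc b\<close> gates.\<close>

lemma kernel_circuit:
  assumes w: "wavelet_filter M h" and M: "M = 2 * Suc K" "2 ^ b < M" "M \<le> 2 ^ Suc b"
    and m: "M \<le> 2 ^ m" "0 < m" "m \<le> n"
  shows "\<exists>C. (\<forall>g\<in>set C. allowed_gate (n + (b + 2)) g) \<and>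
    length C \<le> 36 * n + 24 + 18 * (M * Suc b) \<and>
    (\<forall>\<psi> y. vanishes {n..<n + (b + 2)} \<psi> \<longrightarrow> sem C \<psi> y = (if \<exists>i\<in>{n..<n + (b + 2)}. y i then 0
      else fir (Suc K) (wavelet_matrix M h) (line [1..<m] \<psi> y) (rval [1..<m] y) (y 0)))"
proof -
  let ?A = "wavelet_matrix M h"
  have P: "paraunitary (Suc K) ?A" by (rule paraunitary_wavelet[OF w M(1)])
  show ?thesis
  proof (cases "K = 0")
    \<comment> \<open>For \<open>M = 2\<close> the filter is a single rotation. Then
      \<open>b\<close> is 0, and the general circuit would lack two distinct carry wires for
      \<open>z\<close> and \<open>w\<close>.\<close>
    case True
    have o: "orth (?A 0)" using P True by (fastforce simp: paraunitary_def orth_def)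
    have "sem [rot_gate (?A 0)] \<psi> y = (if \<exists>i\<in>{n..<n + (b + 2)}. y i then 0
      else fir (Suc K) ?A (line [1..<m] \<psi> y) (rval [1..<m] y) (y 0))"
      if v: "vanishes {n..<n + (b + 2)} \<psi>" for \<psi> y
    proof (cases "\<exists>i\<in>{n..<n + (b + 2)}. y i")
      case True
      then obtain i where i: "i \<in> {n..<n + (b + 2)}" "y i" by blast
      have "(y(0 := t)) i" for t using i m by auto
      then have "\<psi> (y(0 := t)) = 0" for t using v i(1) unfolding vanishes_def by blast
      then show ?thesis using True by (simp add: gsem_rot_gate)
    next
      case False
      then show ?thesis using \<open>K = 0\<close> by (simp add: gsem_rot_gate fir_def line_def)
    qed
    then show ?thesis using o m by (intro exI[of _ "[rot_gate (?A 0)]"]) (auto simp: allowed_rot_gate)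
  next
    case False
    have b: "0 < b" using M False by (cases b) auto
    have "(2::nat) ^ b < 2 ^ m" by (rule less_le_trans[OF M(2) m(1)])
    then have bm: "b < m" by simp
    obtain xs where xs: "length xs \<le> 4 * K + 1" "\<forall>x\<in>set xs. orth_step x"
      "lsteps xs = fir (Suc K) ?A" "reach_down K (lsteps (steps_inv xs))"
      using paraunitary_factorization[OF P] by blast
    define r q as where "r = [1..<Suc b]" and "q = [Suc b..<m]" and "as = [Suc n..<n + (b + 2)]"
    define C where "C = filter_circ r q n as (Suc n) (Suc (Suc n)) xs"
    have rq: "r @ q = [1..<m]"
      using bm upt_add_eq_append[of 1 "Suc b" "m - Suc b"] by (simp add: r_def q_def del: upt_Suc)
    have cas: "n # as = [n..<n + (b + 2)]" by (simp add: as_def upt_conv_Cons)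
    have d: "distinct (0 # r @ q @ n # as)"
      using bm m by (auto simp: r_def q_def as_def)
    have len: "length as = Suc (length r)" by (simp add: as_def r_def)
    have z: "Suc n \<in> set as" "Suc (Suc n) \<in> set as" "Suc n \<noteq> Suc (Suc n)"
      using b by (auto simp: as_def)
    have d_big: "distinct (0 # as @ (r @ [n]))" and d_loc: "distinct (0 # tl as @ r)"
      using d len by (cases as; auto)+
    have sub: "set (0 # r @ q @ n # as) \<subseteq> {..<n + (b + 2)}"
      using bm m by (auto simp: r_def q_def as_def)
    have sub_big: "set (0 # as @ (r @ [n])) \<subseteq> {..<n + (b + 2)}"
      and sub_loc: "set (0 # tl as @ r) \<subseteq> {..<n + (b + 2)}"
      using sub len by (cases as; auto)+
    have "distinct (n # Suc n # Suc (Suc n) # 0 # q)" using d z by auto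
    moreover have "set (n # Suc n # Suc (Suc n) # 0 # q) \<subseteq> {..<n + (b + 2)}" using sub z by auto
    ultimately have inc: "prog_on {..<n + (b + 2)} (split_inc n (Suc n) (Suc (Suc n)) 0 q)"
      "length (split_inc n (Suc n) (Suc (Suc n)) 0 q) \<le> 36 * length q + 24"
      by (simp_all only: prog_on_split_inc length_split_inc)
    have "\<forall>g\<in>set C. allowed_gate (n + (b + 2)) g"
      using allowed_steps_circ[OF d_big sub_big xs(2)] allowed_circ[OF inc(1)]
        allowed_steps_circ[OF d_loc sub_loc orth_steps_inv[OF xs(2)]]
      unfolding C_def filter_circ_def set_append by blast
    moreover have "length C \<le> 36 * n + 24 + 18 * (M * Suc b)"
    proof -
      have "length (steps_circ as (r @ [n]) xs) \<le> 3 * Suc b * (2 * M)"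
      proof -
        have "length (steps_circ as (r @ [n]) xs) \<le> 3 * length (r @ [n]) * length xs"
          by (rule length_steps_circ) simp
        also have "\<dots> \<le> 3 * Suc b * (2 * M)"
          using xs(1) M(1) by (intro mult_le_mono) (auto simp: r_def)
        finally show ?thesis .
      qed
      moreover have "length (steps_circ (tl as) r (steps_inv xs)) \<le> 3 * Suc b * (2 * M)"
      proof -
        have "length (steps_circ (tl as) r (steps_inv xs)) \<le> 3 * length r * length (steps_inv xs)"
          by (rule length_steps_circ) (use b in \<open>simp add: r_def\<close>)
        also have "\<dots> \<le> 3 * Suc b * (2 * M)"
          using xs(1) M(1) by (intro mult_le_mono) (auto simp: r_def steps_inv_def)
        finally show ?thesis .
      qed
      moreover have "length q \<le> n" using m by (simp add: q_def)
      moreover have "3 * Suc b * (2 * M) = 6 * (M * Suc b)" by (simp only: mult_ac)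
      ultimately show ?thesis
        using inc(2) unfolding C_def filter_circ_def length_append length_circ by linarith
    qed
    moreover have "sem C \<psi> y = (if \<exists>i\<in>{n..<n + (b + 2)}. y i then 0
      else fir (Suc K) ?A (line [1..<m] \<psi> y) (rval [1..<m] y) (y 0))"
      if v: "vanishes {n..<n + (b + 2)} \<psi>" for \<psi> y
    proof -
      have set_cas: "set (n # as) = {n..<n + (b + 2)}" by (simp only: cas set_upt)
      have up: "reach_up K (lsteps xs)" unfolding xs(3) by (rule reach_up_fir)
      have "K < 2 ^ b" using M(1,3) by simp
      then have "int K < 2 ^ b" by (metis of_nat_less_iff of_nat_numeral of_nat_power)
      moreover have "length r = b" by (simp add: r_def del: upt_Suc)
      ultimately have K: "int K \<le> 2 ^ length r" by simp
      have v': "vanishes (set (n # as)) \<psi>" using v by (simp only: set_cas)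
      show ?thesis
        using sem_filter_circ[OF d len z xs(2) up xs(4) K v', of y]
        by (simp only: C_def set_cas rq xs(3))
    qed
    ultimately show ?thesis by blast
  qed
qed

text \<open>Absorbs the logarithmic factor of the short filters into
  \<open>M powr (3 / 2)\<close>.\<close>

lemma Suc_le_sqrt:
  assumes "2 ^ b < M"
  shows "real (Suc b) \<le> 3 * sqrt (real M)"
proof -
  have "(Suc b)\<^sup>2 \<le> 9 * 2 ^ b"
  proof (induction b)
    case (Suc b)
    have "b < 2 ^ b" by (rule less_exp)
    then have "(Suc b)\<^sup>2 + 2 * b + 3 \<le> 9 * 2 ^ Suc b" using Suc unfolding power_Suc by linarith
    then show ?case by (simp add: power2_eq_square)
  qed simp
  also have "\<dots> \<le> 9 * M" using assms by simp
  finally have "(real (Suc b))\<^sup>2 \<le> 9 * real M"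
    by (metis of_nat_le_iff of_nat_mult of_nat_numeral of_nat_power)
  then have "real (Suc b) \<le> sqrt (9 * real M)" by (rule real_le_rsqrt)
  then show ?thesis by (simp add: real_sqrt_mult)
qed

text \<open>Earlier levels act on longer registers, so the size condition at the last level covers
  them all.\<close>

lemma packet_circuit:
  assumes w: "wavelet_filter M h" and M: "M = 2 * Suc K" "2 ^ b < M" "M \<le> 2 ^ Suc b"
    and d: "d \<le> n" "M \<le> 2 ^ (n - d + 1)"
  shows "\<exists>C. acts n (b + 2) C (packet_qwt M h n d) \<and>
    length C \<le> d * (63 * n + 18 * (M * Suc b))"
  using d
proof (induction d)
  case 0
  then show ?case using acts_Nil by (intro exI[of _ "[]"]) simp
next
  case (Suc d)
  have "(2::nat) ^ (n - Suc d + 1) \<le> 2 ^ (n - d + 1)" by (rule power_increasing) auto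
  then have "M \<le> 2 ^ (n - d + 1)" using Suc.prems(2) by (rule order_trans[rotated])
  then obtain C where C: "acts n (b + 2) C (packet_qwt M h n d)"
    "length C \<le> d * (63 * n + 18 * (M * Suc b))" using Suc by auto
  define m where "m = n - Suc d + 1"
  have m: "M \<le> 2 ^ m" "0 < m" "m \<le> n" using Suc.prems by (auto simp: m_def)
  obtain L where L: "\<forall>g\<in>set L. allowed_gate (n + (b + 2)) g"
    "length L \<le> 36 * n + 24 + 18 * (M * Suc b)"
    and sem: "\<And>\<psi> y. vanishes {n..<n + (b + 2)} \<psi> \<Longrightarrow> sem L \<psi> y = (if \<exists>i\<in>{n..<n + (b + 2)}. y i then 0
      else fir (Suc K) (wavelet_matrix M h) (line [1..<m] \<psi> y) (rval [1..<m] y) (y 0))"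
    using kernel_circuit[OF w M m] by blast
  have "acts n (b + 2) (L @ circ (rotation (m - 1))) (packet_level M h n (Suc d))"
    by (rule acts_level[OF M(1) m(1) m_def m(3) L(1) sem])
  then have "acts n (b + 2) (C @ L @ circ (rotation (m - 1))) (packet_qwt M h n (Suc d))"
    using acts_append[OF C(1)] by simp
  \<comment> \<open>The increment costs at most \<open>36 * n + 24\<close> and the rotation at most
    \<open>3 * n\<close>; with \<open>n\<close> positive this is at most
    \<open>63 * n\<close>.\<close>
  moreover have "length (C @ L @ circ (rotation (m - 1))) \<le> Suc d * (63 * n + 18 * (M * Suc b))"
    using C(2) L(2) m unfolding mult_Suc length_append length_circ length_rotation by linarith
  ultimately show ?case by blast
qed

theorem theorem3:
  shows "\<exists>C::real. \<forall>M h n d.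
    wavelet_filter M h \<and> 0 < d \<and> d \<le> n \<and> M \<le> 2 ^ (n - d + 1) \<longrightarrow>
    (\<exists>Cs. implements n (nat \<lceil>log 2 (real M)\<rceil> + 1) Cs (packet_qwt M h n d) \<and>
          real (length Cs) \<le> C * (real d * real n - real d ^ 2 / 2)
                              + C * (real d * real M powr (3 / 2)))"
proof (intro exI[of _ 126] allI impI)
  fix M h n d
  assume H: "wavelet_filter M h \<and> 0 < d \<and> d \<le> n \<and> M \<le> 2 ^ (n - d + 1)"
  then have "0 < M" "even M" by (auto simp: wavelet_filter_def)
  then have "M = 2 * Suc (M div 2 - 1)" by (auto elim!: evenE)
  then obtain K where K: "M = 2 * Suc K" by blast
  obtain b where b: "2 ^ b < M" "M \<le> 2 ^ Suc b"
    using ex_power_ivl2[of 2 M] K by auto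
  have ceil: "nat \<lceil>log 2 (real M)\<rceil> + 1 = b + 2"
    using ceiling_log_nat_eq_if[of 2 b M] b by simp
  obtain C where C: "acts n (b + 2) C (packet_qwt M h n d)"
    and len: "length C \<le> d * (63 * n + 18 * (M * Suc b))"
    using packet_circuit[OF _ K b, of h d n] H by blast
  have "real (length C) \<le> real (d * (63 * n + 18 * (M * Suc b)))"
    using len by (simp only: of_nat_le_iff)
  also have "\<dots> = real d * (63 * real n + 18 * (real M * real (Suc b)))"
    by (simp only: of_nat_add of_nat_mult of_nat_numeral)
  also have "\<dots> \<le> real d * (63 * real n + 18 * (real M * (3 * sqrt (real M))))"
    using Suc_le_sqrt[OF b(1)] by (intro mult_left_mono add_left_mono) auto
  also have "\<dots> = 63 * (real d * real n) + 54 * (real d * real M powr (3 / 2))"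
  proof -
    have "real M powr (3 / 2) = real M powr (1 + 1 / 2)" by simp
    also have "\<dots> = real M * sqrt (real M)"
      using \<open>0 < M\<close> by (subst powr_add) (simp add: powr_half_sqrt)
    finally show ?thesis by (simp add: algebra_simps)
  qed
  \<comment> \<open>As \<open>d\<close> is at most \<open>n\<close>, the product
    \<open>d * n\<close> is at most twice \<open>d * n - d^2 / 2\<close>, which doubles 63 to
    126.\<close>
  also have "\<dots> \<le> 126 * (real d * real n - real d ^ 2 / 2) + 126 * (real d * real M powr (3 / 2))"
  proof -
    have "real d ^ 2 \<le> real d * real n"
      using H by (simp add: power2_eq_square mult_left_mono)
    moreover have "0 \<le> real d * real M powr (3 / 2)" by simp
    ultimately show ?thesis by simp
  qed
  finally show "\<exists>Cs. implements n (nat \<lceil>log 2 (real M)\<rceil> + 1) Cs (packet_qwt M h n d) \<and>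
          real (length Cs) \<le> 126 * (real d * real n - real d ^ 2 / 2)
                              + 126 * (real d * real M powr (3 / 2))"
    using acts_implements[OF C] unfolding ceil by blast
qed

end
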